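(* Let $R\ge 2r>0$, $d=\sqrt{R(R-2r)}$, and consider the Poristic family with circumradius $R$ and inradius $r$. For a Poristic triangle $T$ let $I_3'$ be the inconic of the excentral triangle of $T$ centered on the circumcenter of the excentral triangle, with major and minor semiaxes $\mu_3'\ge\nu_3'$. Then $\mu_3'=R+d$ and $\nu_3'=R-d$ for every $T$ in the family; i.e. over the family $I_3'$ rigidly rotates about the fixed point $X_{40}$.
   Context: Poristic family: fix in the plane a circle (the circumcircle) with center $X_3$ and radius $R$ and a circle (the incircle) with center $X_1$ and radius $r$, where $|X_1X_3|=d=\sqrt{R(R-2r)}$. The Poristic family is the one-parameter family of all triangles having these two circles as circumcircle and incircle. $X_{40}$ (Bevan point) is the reflection of the incenter $X_1$ about the circumcenter $X_3$; it is fixed over the family. The excentral triangle of a triangle is the triangle whose vertices are its three excenters; its circumcenter is $X_{40}$. An inconic of a triangle centered on a given point is the conic with that center tangent to the three sidelines of the triangle. *)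

theory Defs
  imports "HOL-Analysis.Analysis"
begin

type_synonym point = "real^2"
type_synonym triangle = "point \<times> point \<times> point"

definition line_through :: "point \<Rightarrow> point \<Rightarrow> point set" where
  "line_through P Q = affine hull {P, Q}"

definition touches_at :: "point \<Rightarrow> real \<Rightarrow> point set \<Rightarrow> point \<Rightarrow> bool" where
  "touches_at c \<rho> L P \<longleftrightarrow> sphere c \<rho> \<inter> L = {P}"

fun is_circumcircle :: "triangle \<Rightarrow> point \<Rightarrow> real \<Rightarrow> bool" where
  "is_circumcircle (A, B, C) c \<rho> \<longleftrightarrow> 0 < \<rho> \<and> {A, B, C} \<subseteq> sphere c \<rho>"

definition circumcenter :: "triangle \<Rightarrow> point" where
  "circumcenter T = (THE c. \<exists>\<rho>. is_circumcircle T c \<rho>)"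

text \<open>The incircle touches each of the three sides at an interior point of that side. This
  excludes the excircles, each of which touches two of the sidelines outside the triangle.\<close>

fun is_incircle :: "triangle \<Rightarrow> point \<Rightarrow> real \<Rightarrow> bool" where
  "is_incircle (A, B, C) c \<rho> \<longleftrightarrow> 0 < \<rho> \<and>
     (\<exists>P\<in>open_segment B C. touches_at c \<rho> (line_through B C) P) \<and>
     (\<exists>P\<in>open_segment C A. touches_at c \<rho> (line_through C A) P) \<and>
     (\<exists>P\<in>open_segment A B. touches_at c \<rho> (line_through A B) P)"

text \<open>The excircle opposite \<open>A\<close> touches the side \<open>BC\<close> and the extensions of the sides \<open>AB\<close>
  and \<open>AC\<close> beyond \<open>B\<close> and \<open>C\<close>.\<close>

definition is_excircle :: "point \<Rightarrow> point \<Rightarrow> point \<Rightarrow> point \<Rightarrow> real \<Rightarrow> bool" where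
  "is_excircle A B C c \<rho> \<longleftrightarrow> 0 < \<rho> \<and>
     (\<exists>P\<in>open_segment B C. touches_at c \<rho> (line_through B C) P) \<and>
     (\<exists>P. B \<in> open_segment A P \<and> touches_at c \<rho> (line_through A B) P) \<and>
     (\<exists>P. C \<in> open_segment A P \<and> touches_at c \<rho> (line_through A C) P)"

definition excenter :: "point \<Rightarrow> point \<Rightarrow> point \<Rightarrow> point" where
  "excenter A B C = (THE c. \<exists>\<rho>. is_excircle A B C c \<rho>)"

fun excentral :: "triangle \<Rightarrow> triangle" where
  "excentral (A, B, C) = (excenter A B C, excenter B C A, excenter C A B)"

definition poristic_family :: "point \<Rightarrow> real \<Rightarrow> point \<Rightarrow> real \<Rightarrow> triangle set" where
  "poristic_family X3 R X1 r =
     {(A, B, C) | A B C. \<not> collinear {A, B, C} \<and>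
        is_circumcircle (A, B, C) X3 R \<and> is_incircle (A, B, C) X1 r}"

text \<open>For a symmetric invertible matrix \<open>M\<close>, \<open>conic c M\<close> is the nondegenerate conic (ellipse or
  hyperbola) with center \<open>c\<close> given by the quadratic form of \<open>M\<close>. Its tangent line at a point
  \<open>p\<close> of the conic is the polar of \<open>p\<close>.\<close>

definition conic :: "point \<Rightarrow> real^2^2 \<Rightarrow> point set" where
  "conic c M = {x. (x - c) \<bullet> (M *v (x - c)) = 1}"

definition conic_tangent :: "point \<Rightarrow> real^2^2 \<Rightarrow> point set \<Rightarrow> bool" where
  "conic_tangent c M L \<longleftrightarrow> (\<exists>p\<in>conic c M. L = {x. (p - c) \<bullet> (M *v (x - c)) = 1})"

fun is_inconic :: "triangle \<Rightarrow> point \<Rightarrow> point set \<Rightarrow> bool" where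
  "is_inconic (A, B, C) c E \<longleftrightarrow>
     (\<exists>M. transpose M = M \<and> invertible M \<and> E = conic c M \<and>
        conic_tangent c M (line_through B C) \<and>
        conic_tangent c M (line_through C A) \<and>
        conic_tangent c M (line_through A B))"

definition inconic :: "triangle \<Rightarrow> point \<Rightarrow> point set" where
  "inconic T c = (THE E. is_inconic T c E)"

definition is_ellipse :: "point set \<Rightarrow> point \<Rightarrow> real \<Rightarrow> real \<Rightarrow> bool" where
  "is_ellipse E c \<mu> \<nu> \<longleftrightarrow> 0 < \<nu> \<and> \<nu> \<le> \<mu> \<and>
     (\<exists>u v. norm u = 1 \<and> norm v = 1 \<and> orthogonal u v \<and>
        E = {c + x *\<^sub>R u + y *\<^sub>R v | x y. (x / \<mu>)\<^sup>2 + (y / \<nu>)\<^sup>2 = 1})"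

definition I3' :: "triangle \<Rightarrow> point set" where
  "I3' T = inconic (excentral T) (circumcenter (excentral T))"

definition rotate_about :: "point \<Rightarrow> real^2^2 \<Rightarrow> point \<Rightarrow> point" where
  "rotate_about c Q x = c + Q *v (x - c)"

end

(* Write u = A - X1 for a vertex A, with x, y, z the tangent lengths to the incircle, and let
   K = R^2 - d^2. The excenter opposite A is X1 - ((y + z) / x) u, and the excentral sideline
   through A is the external bisector {p. u . (p - X40) = K}. Hence the conic centered at X40 with
   matrix M is the inconic iff N = M^-1 satisfies u . N u = K^2 for the three vertices, and this
   determines N.

   To exhibit N, use complex coordinates with X3 = 0, incenter i and vertices z1, z2, z3. The
   bisector condition at z1 becomes (z1 - i)^2 cnj (z2 z3) = (cnj i z1 - R^2)^2. Therefore the form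
   (R^2 + d^2) |w|^2 + (2 / R^2) Re (i cnj (z1 z2 z3) w^2) takes the value K^2 at each zk - i; its
   eigenvalues are R^2 + d^2 +- 2 R d = (R +- d)^2. *)

theory Submission
  imports Defs
begin

text \<open>Rigid rotation can be read off the form in complex coordinates. Its trace part is
  constant. The coefficient of its traceless part, a multiple of \<open>i * cnj (z1 z2 z3)\<close>,
  has constant modulus, since each \<open>zk\<close> has modulus \<open>R\<close> and
  \<open>i\<close> has modulus \<open>d\<close>. Only its phase depends on the triangle, and the
  major axis halves the argument of the conjugate coefficient. The product is symmetric in the
  vertices, so one axis serves all three conditions.

  Three values determine \<open>N\<close> because symmetric 2 x 2 matrices form a three-dimensional
  space and the vectors from the incenter to the vertices are pairwise independent.

  The obstacle is that excenter, circumcenter and inconic are all given by \<open>THE\<close>, with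
  circle tangency stated through intersection sets, so each needs uniqueness as well as existence.
  Tangent lengths keep this algebraic: inner products of the vectors from the incenter are
  polynomials in \<open>x\<close>, \<open>y\<close>, \<open>z\<close>, \<open>r\<close>, tied by the
  single relation \<open>heron\<close>. Every uniqueness argument ends in the same fact, that a
  plane vector orthogonal to two sides of a triangle is zero.\<close>

lemma inner_real2: "(x::real^2) \<bullet> y = x$1 * y$1 + x$2 * y$2"
  by (simp add: inner_vec_def sum_2)

lemma vec_eq_iff2: "(x::'a^2) = y \<longleftrightarrow> x$1 = y$1 \<and> x$2 = y$2"
  by (simp add: vec_eq_iff forall_2)

section \<open>Right-angle rotation and orthonormal frames in the plane\<close>

definition perp :: "real^2 \<Rightarrow> real^2" where
  "perp e = vector [- (e$2), e$1]"

lemma perp_nth [simp]: "perp e $ 1 = - (e$2)" "perp e $ 2 = e$1"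
  by (simp_all add: perp_def)

lemma inner_perp_self [simp]: "e \<bullet> perp e = 0" "perp e \<bullet> e = 0"
  by (simp_all add: inner_real2)

lemma norm_perp [simp]: "norm (perp e) = norm e"
  by (simp add: norm_eq_sqrt_inner inner_real2 algebra_simps)

lemma perp_expansion:
  assumes "norm e = 1"
  shows "x = (e \<bullet> x) *\<^sub>R e + (perp e \<bullet> x) *\<^sub>R perp e"
proof -
  have "(e$1)\<^sup>2 + (e$2)\<^sup>2 = 1"
    using assms by (simp add: norm_eq_1 inner_real2 power2_eq_square)
  then have t: "t = ((e$1)\<^sup>2 + (e$2)\<^sup>2) * t" for t
    by simp
  have "x$1 = ((e \<bullet> x) *\<^sub>R e + (perp e \<bullet> x) *\<^sub>R perp e)$1"
    by (subst t) (simp add: inner_real2 power2_eq_square algebra_simps)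
  moreover have "x$2 = ((e \<bullet> x) *\<^sub>R e + (perp e \<bullet> x) *\<^sub>R perp e)$2"
    by (subst t) (simp add: inner_real2 power2_eq_square algebra_simps)
  ultimately show ?thesis
    unfolding vec_eq_iff2 by blast
qed

lemma orthogonal_imp_perp:
  assumes "norm u = 1" "norm v = 1" "orthogonal u (v::real^2)"
  shows "v = perp u \<or> v = - perp u"
proof -
  obtain k where v: "v = k *\<^sub>R perp u"
    using perp_expansion[OF assms(1), of v] assms(3) by (auto simp: orthogonal_def)
  then have "\<bar>k\<bar> = 1"
    using assms(1,2) by simp
  then have "k = 1 \<or> k = - 1"
    by linarith
  then show ?thesis
    using v by auto
qed

text \<open>In the plane, the vectors orthogonal to a nonzero \<open>e\<close> are the multiples of
  \<open>perp e\<close>, so a nonzero \<open>e\<close> would put \<open>B\<close> and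
  \<open>C\<close> on one line through \<open>A\<close>.\<close>

lemma noncollinear_inner_eq_0:
  fixes A B C e :: "real^2"
  assumes nc: "\<not> collinear {A, B, C}" and "e \<bullet> (B - A) = 0" "e \<bullet> (C - A) = 0"
  shows "e = 0"
proof (rule ccontr)
  assume "e \<noteq> 0"
  define f where "f = e /\<^sub>R norm e"
  have f: "norm f = 1"
    using \<open>e \<noteq> 0\<close> by (simp add: f_def)
  have BA: "B - A = (perp f \<bullet> (B - A)) *\<^sub>R perp f"
    using perp_expansion[OF f, of "B - A"] assms(2) by (simp add: f_def)
  have CA: "C - A = (perp f \<bullet> (C - A)) *\<^sub>R perp f"
    using perp_expansion[OF f, of "C - A"] assms(3) by (simp add: f_def)
  have "\<exists>k. P = A + k *\<^sub>R perp f" if "P \<in> {A, B, C}" for P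
  proof -
    have "A = A + 0 *\<^sub>R perp f" by simp
    moreover have "B = A + (perp f \<bullet> (B - A)) *\<^sub>R perp f"
      by (subst BA[symmetric]) simp
    moreover have "C = A + (perp f \<bullet> (C - A)) *\<^sub>R perp f"
      by (subst CA[symmetric]) simp
    ultimately show ?thesis using that by blast
  qed
  then have "collinear {A, B, C}"
    by (subst collinear_alt) blast
  then show False using nc by simp
qed

section \<open>Lines and the circles touching them\<close>

lemma mem_line_through: "T \<in> line_through P Q \<longleftrightarrow> (\<exists>k. T = P + k *\<^sub>R (Q - P))"
  by (auto simp: line_through_def affine_hull_2_alt)

lemma line_through_eq_hyperplane:
  fixes P Q a :: "real^2"
  assumes "P \<noteq> Q" "a \<noteq> 0" "a \<bullet> P = h" "a \<bullet> Q = h"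
  shows "line_through P Q = {p. a \<bullet> p = h}"
proof (intro set_eqI iffI)
  fix p assume "p \<in> line_through P Q"
  then show "p \<in> {p. a \<bullet> p = h}"
    using assms by (auto simp: mem_line_through inner_simps)
next
  fix p assume "p \<in> {p. a \<bullet> p = h}"
  then have p: "a \<bullet> (p - P) = 0" and Q: "a \<bullet> (Q - P) = 0"
    using assms by (auto simp: inner_simps)
  have "collinear {P, Q, p}"
    using noncollinear_inner_eq_0[OF _ Q p] assms(2) by blast
  then show "p \<in> line_through P Q"
    using assms(1) unfolding line_through_def by (rule collinear_3_imp_in_affine_hull)
qed

text \<open>Turns tangency as a one-point intersection into Pythagoras: the radius to
  \<open>T\<close> must be orthogonal to the line, since otherwise the line would meet the circle a
  second time.\<close>

lemma touches_atD:
  assumes t: "touches_at c \<rho> (line_through P Q) T" and X: "X \<in> line_through P Q"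
  shows "(dist c X)\<^sup>2 = \<rho>\<^sup>2 + (dist T X)\<^sup>2"
proof -
  define e where "e = Q - P"
  have T: "T \<in> line_through P Q" "dist c T = \<rho>"
    using t unfolding touches_at_def by (metis IntD1 IntD2 insertI1 mem_sphere)+
  obtain k where k: "T = P + k *\<^sub>R e"
    using T by (auto simp: mem_line_through e_def)
  obtain l where l: "X = P + l *\<^sub>R e"
    using X by (auto simp: mem_line_through e_def)
  have orth: "(c - T) \<bullet> e = 0"
  proof (cases "e = 0")
    case False
    \<comment> \<open>\<open>T + m *\<^sub>R e\<close> is the mirror image of \<open>T\<close> in
      the foot of the perpendicular from \<open>c\<close>, hence the second intersection with the
      circle.\<close>
    define m where "m = 2 * ((c - T) \<bullet> e) / (e \<bullet> e)"
    define T' where "T' = T + m *\<^sub>R e"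
    have "m * (e \<bullet> e) = 2 * ((c - T) \<bullet> e)"
      using False by (simp add: m_def)
    then have "m * (m * (e \<bullet> e) - 2 * ((c - T) \<bullet> e)) = 0"
      by simp
    then have "(norm (c - T'))\<^sup>2 = (norm (c - T))\<^sup>2"
      unfolding power2_norm_eq_inner T'_def by (simp add: inner_simps inner_commute algebra_simps)
    then have "dist c T' = \<rho>"
      using T by (simp add: dist_norm)
    moreover have "T' \<in> line_through P Q"
      unfolding mem_line_through T'_def k e_def
      by (intro exI[of _ "k + m"]) (simp add: algebra_simps)
    ultimately have "T' \<in> sphere c \<rho> \<inter> line_through P Q"
      by simp
    then have "T' = T"
      using t unfolding touches_at_def by blast
    then show ?thesis
      using False by (simp add: T'_def m_def)
  qed simp
  have XT: "X - T = (l - k) *\<^sub>R e"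
    by (simp add: k l algebra_simps)
  have "(norm (c - X))\<^sup>2 = (norm ((c - T) - (X - T)))\<^sup>2"
    by simp
  also have "\<dots> = (norm (c - T))\<^sup>2 + (norm (X - T))\<^sup>2 - 2 * ((c - T) \<bullet> (X - T))"
    unfolding power2_norm_eq_inner by (simp add: inner_simps inner_commute)
  also have "(c - T) \<bullet> (X - T) = 0"
    by (simp add: XT orth)
  finally show ?thesis
    using T by (simp add: dist_norm norm_minus_commute)
qed

text \<open>\<open>m\<close> is the signed distance from \<open>P\<close> to the contact point,
  counted towards \<open>Q\<close>. Along the line, the squared distance from \<open>c\<close> is
  \<open>\<rho>\<^sup>2\<close> plus the squared distance from that point, so the circle meets the
  line nowhere else.\<close>

lemma touches_atI:
  assumes "P \<noteq> Q" "0 \<le> \<rho>" "(dist c P)\<^sup>2 = \<rho>\<^sup>2 + m\<^sup>2" "(c - P) \<bullet> (Q - P) = m * dist P Q"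
  shows "touches_at c \<rho> (line_through P Q) (P + (m / dist P Q) *\<^sub>R (Q - P))"
proof -
  define e where "e = Q - P"
  define k where "k = m / dist P Q"
  have e: "e \<bullet> e = (dist P Q)\<^sup>2"
    by (simp add: e_def dist_norm norm_minus_commute power2_norm_eq_inner[symmetric])
  have m: "m = k * dist P Q"
    using assms(1) by (simp add: k_def)
  have on: "(dist c (P + l *\<^sub>R e))\<^sup>2 = \<rho>\<^sup>2 + ((l - k) * dist P Q)\<^sup>2" for l
  proof -
    have "(dist c (P + l *\<^sub>R e))\<^sup>2 = (norm (c - P))\<^sup>2 - 2 * l * ((c - P) \<bullet> e) + l\<^sup>2 * (e \<bullet> e)"
      unfolding dist_norm power2_norm_eq_inner
      by (simp add: inner_diff_left inner_diff_right inner_add_left inner_add_right inner_commute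
          algebra_simps power2_eq_square)
    then show ?thesis
      using assms(3,4) e unfolding dist_norm e_def[symmetric]
      by (simp add: m dist_norm algebra_simps power2_eq_square)
  qed
  have "X \<in> sphere c \<rho> \<inter> line_through P Q \<longleftrightarrow> X = P + k *\<^sub>R e" for X
  proof
    assume X: "X \<in> sphere c \<rho> \<inter> line_through P Q"
    then obtain l where l: "X = P + l *\<^sub>R e"
      by (auto simp: mem_line_through e_def)
    have "((l - k) * dist P Q)\<^sup>2 = 0"
      using on[of l] X l by simp
    then show "X = P + k *\<^sub>R e"
      using assms(1) l by simp
  next
    assume X: "X = P + k *\<^sub>R e"
    have "dist c X = \<rho>"
      using on[of k] assms(2) X by (simp add: power2_eq_iff_nonneg)
    then show "X \<in> sphere c \<rho> \<inter> line_through P Q"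
      using X by (auto simp: mem_line_through e_def)
  qed
  then have "sphere c \<rho> \<inter> line_through P Q = {P + k *\<^sub>R e}"
    by blast
  then show ?thesis
    unfolding touches_at_def k_def e_def .
qed

lemma mem_line_through_ends [simp]: "P \<in> line_through P Q" "Q \<in> line_through P Q"
  by (auto simp: line_through_def hull_inc)

lemma open_segment_dist:
  assumes "P \<in> open_segment B (C::'a::euclidean_space)"
  shows "dist B P + dist P C = dist B C" "0 < dist B P" "0 < dist P C" "B \<noteq> C"
proof -
  have "between (B, C) P"
    using assms by (auto simp: between_mem_segment open_segment_def)
  then show "dist B P + dist P C = dist B C"
    by (simp add: between)
qed (use assms in \<open>auto simp: open_segment_def\<close>)

section \<open>Incenter, tangent lengths and excenters\<close>

text \<open>\<open>x\<close>, \<open>y\<close>, \<open>z\<close> are the tangent lengths from \<open>A\<close>, \<open>B\<close>, \<open>C\<close> to the incircle.\<close>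

locale incenter_triangle =
  fixes A B C I :: "real^2" and x y z r :: real
  assumes noncollinear: "\<not> collinear {A, B, C}"
    and pos: "0 < x" "0 < y" "0 < z" "0 < r"
    and sides: "dist A B = x + y" "dist B C = y + z" "dist C A = z + x"
    and incenter: "(A - I) \<bullet> (A - I) = x\<^sup>2 + r\<^sup>2" "(B - I) \<bullet> (B - I) = y\<^sup>2 + r\<^sup>2"
      "(C - I) \<bullet> (C - I) = z\<^sup>2 + r\<^sup>2"

lemma touches_at_tangent_length:
  assumes "touches_at c \<rho> (line_through P Q) T" "touches_at c \<rho> (line_through P S) T'"
  shows "dist P T = dist P T'"
proof -
  have "(dist T P)\<^sup>2 = (dist T' P)\<^sup>2"
    using touches_atD[OF assms(1), of P] touches_atD[OF assms(2), of P] by simp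
  then show ?thesis
    by (simp add: power2_eq_iff_nonneg dist_commute)
qed

lemma line_through_commute: "line_through P Q = line_through Q P"
  by (simp add: line_through_def insert_commute)

text \<open>The contact points are interior to the sides, so each side is the sum, not the
  difference, of two tangent lengths. This is where the incircle differs from an excircle.\<close>

lemma is_incircle_imp_incenter_triangle:
  assumes "\<not> collinear {A, B, C}" and inc: "is_incircle (A, B, C) I r"
  obtains x y z where "incenter_triangle A B C I x y z r"
proof -
  obtain D E F where D: "D \<in> open_segment B C" "touches_at I r (line_through B C) D"
    and E: "E \<in> open_segment C A" "touches_at I r (line_through C A) E"
    and F: "F \<in> open_segment A B" "touches_at I r (line_through A B) F"
    and r: "0 < r"
    using inc by auto
  have eqs: "dist A E = dist A F" "dist B F = dist B D" "dist C D = dist C E"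
    using D(2) E(2) F(2) by (metis touches_at_tangent_length line_through_commute)+
  have AI: "(P - I) \<bullet> (P - I) = (dist P T)\<^sup>2 + r\<^sup>2"
    if "touches_at I r (line_through P Q) T" for P Q T
    using touches_atD[OF that, of P]
    by (simp add: dist_norm norm_minus_commute power2_norm_eq_inner[symmetric])
  have "incenter_triangle A B C I (dist A F) (dist B D) (dist C E) r"
  proof
    show "0 < dist A F" "0 < dist B D" "0 < dist C E"
      using open_segment_dist D(1) E(1) F(1) by blast+
    show "dist A B = dist A F + dist B D" "dist B C = dist B D + dist C E"
      "dist C A = dist C E + dist A F"
      using open_segment_dist(1)[OF D(1)] open_segment_dist(1)[OF E(1)]
        open_segment_dist(1)[OF F(1)] eqs by (simp_all add: dist_commute)
  qed (use assms(1) r AI[OF D(2)] AI[OF E(2)] AI[OF F(2)] in auto)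
  then show ?thesis by (rule that)
qed

text \<open>Cyclic symmetry: facts are proved at the vertex \<open>A\<close> only and carried over
  to \<open>B\<close> and \<open>C\<close>.\<close>

lemma incenter_triangle_rotate:
  "incenter_triangle A B C I x y z r \<Longrightarrow> incenter_triangle B C A I y z x r"
  by (simp add: incenter_triangle_def insert_commute)

context incenter_triangle
begin

lemmas rotate1 = incenter_triangle_rotate[OF incenter_triangle_axioms]
lemmas rotate2 = incenter_triangle_rotate[OF rotate1]

lemma inner_eq_0_imp_eq_0: "e \<bullet> (B - A) = 0 \<Longrightarrow> e \<bullet> (C - A) = 0 \<Longrightarrow> e = 0"
  using noncollinear_inner_eq_0[OF noncollinear] .

lemma inner_incenter_AB: "(A - I) \<bullet> (B - I) = r\<^sup>2 - x * y"
proof -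
  have "(x + y)\<^sup>2 = (norm ((A - I) - (B - I)))\<^sup>2"
    using sides(1) by (simp add: dist_norm)
  also have "\<dots> = (A - I) \<bullet> (A - I) + (B - I) \<bullet> (B - I) - 2 * ((A - I) \<bullet> (B - I))"
    unfolding power2_norm_eq_inner by (simp add: inner_diff_left inner_diff_right inner_commute)
  finally show ?thesis
    unfolding incenter by (simp add: power2_eq_square algebra_simps)
qed

lemma inner_incenter_BC: "(B - I) \<bullet> (C - I) = r\<^sup>2 - y * z"
  using incenter_triangle.inner_incenter_AB[OF rotate1] .

lemma inner_incenter_CA: "(C - I) \<bullet> (A - I) = r\<^sup>2 - z * x"
  using incenter_triangle.inner_incenter_AB[OF rotate2] .

lemmas inner_incenter = incenter inner_incenter_AB inner_incenter_BC inner_incenter_CA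
  inner_incenter_AB[unfolded inner_commute[of "A - I"]]
  inner_incenter_BC[unfolded inner_commute[of "B - I"]]
  inner_incenter_CA[unfolded inner_commute[of "C - I"]]

text \<open>Both facts come from one computation. The left-hand vector has the same inner product
  with \<open>A - I\<close>, \<open>B - I\<close> and \<open>C - I\<close>, so it is orthogonal to
  the sides and must vanish. The common value is then zero, which is the second claim.\<close>

lemma incenter_barycentric:
  "(y + z) *\<^sub>R (A - I) + (z + x) *\<^sub>R (B - I) + (x + y) *\<^sub>R (C - I) = 0" (is "?L = 0")
  and heron: "r\<^sup>2 * (x + y + z) = x * y * z"
proof -
  have A: "?L \<bullet> (A - I) = 2 * (r\<^sup>2 * (x + y + z) - x * y * z)"
    unfolding inner_add_left inner_scaleR_left inner_incenter
    by (simp add: power2_eq_square algebra_simps)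
  have B: "?L \<bullet> (B - I) = 2 * (r\<^sup>2 * (x + y + z) - x * y * z)"
    unfolding inner_add_left inner_scaleR_left inner_incenter
    by (simp add: power2_eq_square algebra_simps)
  have C: "?L \<bullet> (C - I) = 2 * (r\<^sup>2 * (x + y + z) - x * y * z)"
    unfolding inner_add_left inner_scaleR_left inner_incenter
    by (simp add: power2_eq_square algebra_simps)
  have "?L \<bullet> ((B - I) - (A - I)) = 0" "?L \<bullet> ((C - I) - (A - I)) = 0"
    unfolding inner_diff_right[of _ "_ - I"] A B C by simp_all
  then show L: "?L = 0"
    unfolding diff_diff_eq2 diff_add_cancel by (rule inner_eq_0_imp_eq_0)
  show "r\<^sup>2 * (x + y + z) = x * y * z"
    using A unfolding L by simp
qed

text \<open>Equal tangents force the tangent length from \<open>A\<close> to be the semiperimeter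
  \<open>x + y + z\<close>, and those from \<open>B\<close> and \<open>C\<close> to be
  \<open>z\<close> and \<open>y\<close>. The two inner products do not involve
  \<open>\<rho>\<close>, so they fix the center; this gives uniqueness of the excenter.\<close>

lemma excircle_center:
  assumes "is_excircle A B C c \<rho>"
  shows "(c - A) \<bullet> (B - A) = (x + y + z) * (x + y)" "(c - A) \<bullet> (C - A) = (x + y + z) * (z + x)"
proof -
  obtain P Q S where P: "P \<in> open_segment B C" "touches_at c \<rho> (line_through B C) P"
    and Q: "B \<in> open_segment A Q" "touches_at c \<rho> (line_through A B) Q"
    and S: "C \<in> open_segment A S" "touches_at c \<rho> (line_through A C) S"
    using assms unfolding is_excircle_def by blast
  have "dist B Q = dist B P" "dist C P = dist C S" "dist A Q = dist A S"
    using P(2) Q(2) S(2) by (metis touches_at_tangent_length line_through_commute)+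
  then have lens: "dist B P = z" "dist C P = y" "dist A Q = x + y + z"
    using open_segment_dist(1)[OF P(1)] open_segment_dist(1)[OF Q(1)]
      open_segment_dist(1)[OF S(1)] sides by (simp_all add: dist_commute)
  have n: "(dist c A)\<^sup>2 = \<rho>\<^sup>2 + (x + y + z)\<^sup>2" "(dist c B)\<^sup>2 = \<rho>\<^sup>2 + z\<^sup>2"
    "(dist c C)\<^sup>2 = \<rho>\<^sup>2 + y\<^sup>2"
    using touches_atD[OF P(2), of B] touches_atD[OF P(2), of C] touches_atD[OF Q(2), of A] lens
    by (simp_all add: dist_commute)
  have pol: "2 * ((c - A) \<bullet> (X - A)) = (dist c A)\<^sup>2 + (dist A X)\<^sup>2 - (dist c X)\<^sup>2" for X
    unfolding dist_norm power2_norm_eq_inner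
    by (simp add: inner_diff_left inner_diff_right inner_commute algebra_simps)
  show "(c - A) \<bullet> (B - A) = (x + y + z) * (x + y)"
    using pol[of B] unfolding n sides(1) by (simp add: power2_eq_square algebra_simps)
  show "(c - A) \<bullet> (C - A) = (x + y + z) * (z + x)"
    using pol[of C] unfolding n dist_commute[of A C] sides(3)
    by (simp add: power2_eq_square algebra_simps)
qed

text \<open>The homothety with center \<open>A\<close> and ratio \<open>(x + y + z) / x\<close>
  takes the incircle to the excircle, because it stretches the tangent length \<open>x\<close> to
  the semiperimeter.\<close>

lemma is_excircle:
  "is_excircle A B C (A + ((x + y + z) / x) *\<^sub>R (I - A)) ((x + y + z) / x * r)"
proof -
  define k where "k = (x + y + z) / x"
  define J where "J = A + k *\<^sub>R (I - A)"
  define \<rho> where "\<rho> = k * r"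
  have k: "k * x = x + y + z" "0 < k"
    using pos by (simp_all add: k_def)
  have ne: "A \<noteq> B" "B \<noteq> C" "A \<noteq> C"
    using sides pos by auto
  have \<rho>: "0 < \<rho>"
    using k pos by (simp add: \<rho>_def)
  have JA: "(J - A) \<bullet> (B - A) = (x + y + z) * (x + y)" "(J - A) \<bullet> (C - A) = (x + y + z) * (z + x)"
  proof -
    have "(I - A) \<bullet> (B - A) = x * (x + y)"
      using inner_diff_right[of "I - A" "B - I" "A - I"] inner_minus_left[of "A - I"] inner_incenter
      by (simp add: power2_eq_square algebra_simps)
    then show "(J - A) \<bullet> (B - A) = (x + y + z) * (x + y)"
      by (simp add: J_def k(1)[symmetric])
    have "(I - A) \<bullet> (C - A) = x * (z + x)"
      using inner_diff_right[of "I - A" "C - I" "A - I"] inner_minus_left[of "A - I"] inner_incenter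
      by (simp add: power2_eq_square algebra_simps)
    then show "(J - A) \<bullet> (C - A) = (x + y + z) * (z + x)"
      by (simp add: J_def k(1)[symmetric])
  qed
  have "(norm (J - A))\<^sup>2 = k\<^sup>2 * (norm (I - A))\<^sup>2"
    by (simp add: J_def power_mult_distrib)
  also have "\<dots> = k\<^sup>2 * (x\<^sup>2 + r\<^sup>2)"
    by (simp add: norm_minus_commute[of I] power2_norm_eq_inner incenter)
  also have "\<dots> = \<rho>\<^sup>2 + (x + y + z)\<^sup>2"
    unfolding \<rho>_def k(1)[symmetric] by (simp add: power_mult_distrib algebra_simps)
  finally have dA: "(dist J A)\<^sup>2 = \<rho>\<^sup>2 + (x + y + z)\<^sup>2"
    by (simp add: dist_norm)
  have pol: "(dist J X)\<^sup>2 = (dist J A)\<^sup>2 + (dist A X)\<^sup>2 - 2 * ((J - A) \<bullet> (X - A))" for X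
    unfolding dist_norm power2_norm_eq_inner
    by (simp add: inner_diff_left inner_diff_right inner_commute algebra_simps)
  have dB: "(dist J B)\<^sup>2 = \<rho>\<^sup>2 + z\<^sup>2"
    unfolding pol[of B] dA JA sides by (simp add: power2_eq_square algebra_simps)
  have dC: "(dist J C)\<^sup>2 = \<rho>\<^sup>2 + y\<^sup>2"
    unfolding pol[of C] dA JA dist_commute[of A C] sides
    by (simp add: power2_eq_square algebra_simps)
  have "2 * ((J - B) \<bullet> (C - B)) = (dist J B)\<^sup>2 + (dist B C)\<^sup>2 - (dist J C)\<^sup>2"
    unfolding dist_norm power2_norm_eq_inner
    by (simp add: inner_diff_left inner_diff_right inner_commute algebra_simps)
  then have JB: "(J - B) \<bullet> (C - B) = z * (y + z)"
    unfolding dB dC sides by (simp add: power2_eq_square algebra_simps)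
  \<comment> \<open>\<open>l\<close> stands for the side length \<open>dist A X\<close>. The contact
    point on the ray lies at distance \<open>x + y + z\<close> from \<open>A\<close>, which exceeds
    either side at \<open>A\<close>.\<close>
  have beyond: "X \<in> open_segment A (A + ((x + y + z) / l) *\<^sub>R (X - A))"
    if "A \<noteq> X" "0 < l" "l < x + y + z" for X l
  proof -
    define t where "t = l / (x + y + z)"
    have t: "0 < t" "t < 1" "(x + y + z) / l = 1 / t"
      using that by (simp_all add: t_def)
    have "X = (1 - t) *\<^sub>R A + t *\<^sub>R (A + (1 / t) *\<^sub>R (X - A))"
      using t by (simp add: algebra_simps)
    moreover have "A \<noteq> A + (1 / t) *\<^sub>R (X - A)"
      using that t by simp
    ultimately show ?thesis
      unfolding in_segment t(3) using t by blast
  qed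
  have BC: "B + (z / (y + z)) *\<^sub>R (C - B) \<in> open_segment B C"
    unfolding in_segment using ne pos
    by (auto intro!: exI[of _ "z / (y + z)"] simp: algebra_simps)
  show ?thesis
    unfolding is_excircle_def k_def[symmetric] J_def[symmetric] \<rho>_def[symmetric]
  proof (intro conjI bexI exI)
    show "touches_at J \<rho> (line_through B C) (B + (z / (y + z)) *\<^sub>R (C - B))"
      using touches_atI[of B C \<rho> J z] ne \<rho> dB JB sides by simp
    show "touches_at J \<rho> (line_through A B) (A + ((x + y + z) / (x + y)) *\<^sub>R (B - A))"
      using touches_atI[of A B \<rho> J "x + y + z"] ne \<rho> dA JA sides by simp
    show "touches_at J \<rho> (line_through A C) (A + ((x + y + z) / (z + x)) *\<^sub>R (C - A))"
      using touches_atI[of A C \<rho> J "x + y + z"] ne \<rho> dA JA sides by (simp add: dist_commute)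
  qed (use BC beyond ne pos \<rho> in auto)
qed

lemma excenter_eq: "excenter A B C = I - ((y + z) / x) *\<^sub>R (A - I)"
proof -
  have "excenter A B C = A + ((x + y + z) / x) *\<^sub>R (I - A)" (is "_ = ?J")
    unfolding excenter_def
  proof (rule the_equality)
    show "\<exists>\<rho>. is_excircle A B C ?J \<rho>"
      using is_excircle by blast
  next
    fix c assume "\<exists>\<rho>. is_excircle A B C c \<rho>"
    then obtain \<rho> where c: "is_excircle A B C c \<rho>" ..
    have "((c - A) - (?J - A)) \<bullet> (B - A) = 0" "((c - A) - (?J - A)) \<bullet> (C - A) = 0"
      unfolding inner_diff_left[of "c - A"] excircle_center[OF c] excircle_center[OF is_excircle]
      by simp_all
    then have "(c - A) - (?J - A) = 0"
      by (rule inner_eq_0_imp_eq_0)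
    then show "c = ?J" unfolding diff_diff_eq2 diff_add_cancel by simp
  qed
  also have "(x + y + z) / x = 1 + (y + z) / x"
    using pos by (simp add: field_simps)
  finally show ?thesis
    by (simp add: algebra_simps)
qed

end

section \<open>Central conics, their duals, and matrices in an orthonormal frame\<close>

lemma symmetric_matrix_inner:
  fixes M :: "real^'n^'n"
  assumes "transpose M = M"
  shows "x \<bullet> (M *v y) = y \<bullet> (M *v x)"
  using dot_lmul_matrix[of x M y] vector_transpose_matrix[of x M] assms
  by (simp add: inner_commute)

text \<open>\<open>c + n\<close> is the foot of the perpendicular from \<open>c\<close>, and
  \<open>e\<close> is a direction along the hyperplane. Testing the second equation at
  \<open>c + n\<close> and at \<open>c + n + e\<close> leaves no room for a difference
  \<open>q' - q\<close>.\<close>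

lemma hyperplane_normal_unique:
  fixes q q' c :: "'a::real_inner"
  assumes "{p. q \<bullet> (p - c) = 1} = {p. q' \<bullet> (p - c) = 1}" "q \<noteq> 0"
  shows "q' = q"
proof -
  have imp: "q' \<bullet> (p - c) = 1" if "q \<bullet> (p - c) = 1" for p
    using assms(1) that by blast
  define n where "n = q /\<^sub>R (q \<bullet> q)"
  have n: "q \<bullet> n = 1"
    using assms(2) by (simp add: n_def)
  have q'n: "q' \<bullet> n = 1"
    using imp[of "c + n"] n by simp
  define e where "e = (q' - q) - (q \<bullet> (q' - q)) *\<^sub>R n"
  have qe: "q \<bullet> e = 0"
    by (simp add: e_def inner_diff_right n)
  have q'e: "q' \<bullet> e = 0"
    using imp[of "c + n + e"] qe n q'n by (simp add: inner_add_right)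
  have "(q' - q) \<bullet> n = 0"
    using n q'n by (simp add: inner_diff_left)
  then have "q \<bullet> (q' - q) = 0"
    using assms(2) by (simp add: n_def inner_commute)
  then have "e = q' - q"
    by (simp add: e_def)
  then have "(q' - q) \<bullet> (q' - q) = 0"
    using qe q'e by (simp add: inner_diff_left)
  then show ?thesis by simp
qed

text \<open>The dual conic. The line is the polar of \<open>p\<close> exactly when
  \<open>q = M *v (p - c)\<close>, so \<open>p = c + N *v q\<close>, and incidence of
  \<open>p\<close> with the conic becomes the equation on the right. The gain is that tangency is
  linear in \<open>N\<close>.\<close>

lemma conic_tangent_iff_dual:
  assumes sym: "transpose M = M" and inv: "N ** M = mat 1" "M ** N = mat 1" and q: "q \<noteq> 0"
  shows "conic_tangent c M {p. q \<bullet> (p - c) = 1} \<longleftrightarrow> q \<bullet> (N *v q) = 1"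
proof
  have NM: "N *v (M *v w) = w" for w
    by (simp add: matrix_vector_mul_assoc inv)
  assume "conic_tangent c M {p. q \<bullet> (p - c) = 1}"
  then obtain p where p: "p \<in> conic c M"
    and L: "{p. q \<bullet> (p - c) = 1} = {w. (p - c) \<bullet> (M *v (w - c)) = 1}"
    unfolding conic_tangent_def by blast
  have "{p. q \<bullet> (p - c) = 1} = {w. (M *v (p - c)) \<bullet> (w - c) = 1}"
    unfolding L by (simp add: symmetric_matrix_inner[OF sym, of "p - c"] inner_commute)
  then have "M *v (p - c) = q"
    by (rule hyperplane_normal_unique) fact
  then show "q \<bullet> (N *v q) = 1"
    using p NM[of "p - c"] by (auto simp: conic_def inner_commute)
next
  have MN: "M *v (N *v w) = w" for w
    by (simp add: matrix_vector_mul_assoc inv)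
  assume "q \<bullet> (N *v q) = 1"
  then show "conic_tangent c M {p. q \<bullet> (p - c) = 1}"
    unfolding conic_tangent_def
    by (intro bexI[of _ "c + N *v q"])
      (auto simp: conic_def symmetric_matrix_inner[OF sym, of "N *v q"] MN inner_commute)
qed

text \<open>For a unit vector \<open>e\<close>, the symmetric matrix with eigenvectors
  \<open>e\<close> and \<open>perp e\<close> and eigenvalues \<open>l\<close> and
  \<open>m\<close>.\<close>

definition frame_matrix :: "real^2 \<Rightarrow> real \<Rightarrow> real \<Rightarrow> real^2^2" where
  "frame_matrix e l m = (\<chi> i j. l * (e$i * e$j) + m * (perp e$i * perp e$j))"

lemma frame_matrix_mult_vec:
  "frame_matrix e l m *v w = (l * (e \<bullet> w)) *\<^sub>R e + (m * (perp e \<bullet> w)) *\<^sub>R perp e"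
  by (simp add: vec_eq_iff2 frame_matrix_def matrix_vector_mult_def sum_2 inner_real2 algebra_simps)

lemma transpose_frame_matrix: "transpose (frame_matrix e l m) = frame_matrix e l m"
  by (simp add: frame_matrix_def transpose_def mult.commute)

lemma frame_matrix_quadratic:
  "w \<bullet> (frame_matrix e l m *v w) = l * (e \<bullet> w)\<^sup>2 + m * (perp e \<bullet> w)\<^sup>2"
  by (simp add: frame_matrix_mult_vec inner_add_right inner_commute power2_eq_square)

lemma frame_matrix_inverse:
  assumes e: "norm e = 1" and "l \<noteq> 0" "m \<noteq> 0"
  shows "frame_matrix e l m ** frame_matrix e (1 / l) (1 / m) = mat 1"
proof -
  have ee: "e \<bullet> e = 1" "perp e \<bullet> perp e = 1"
    using e by (simp_all add: power2_norm_eq_inner[symmetric])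
  have "(frame_matrix e l m ** frame_matrix e (1 / l) (1 / m)) *v w = mat 1 *v w" for w
    using perp_expansion[OF e, of w] assms(2,3)
    by (simp add: matrix_vector_mul_assoc[symmetric] frame_matrix_mult_vec inner_add_right ee)
  then show ?thesis
    by (simp add: matrix_eq)
qed

definition ellipse :: "real^2 \<Rightarrow> real^2 \<Rightarrow> real \<Rightarrow> real \<Rightarrow> (real^2) set" where
  "ellipse c e \<mu> \<nu> = {c + x *\<^sub>R e + y *\<^sub>R perp e | x y. (x / \<mu>)\<^sup>2 + (y / \<nu>)\<^sup>2 = 1}"

lemma conic_frame_matrix_eq_ellipse:
  assumes e: "norm e = 1"
  shows "conic c (frame_matrix e (1 / \<mu>\<^sup>2) (1 / \<nu>\<^sup>2)) = ellipse c e \<mu> \<nu>"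
proof (intro set_eqI iffI)
  fix p assume p: "p \<in> conic c (frame_matrix e (1 / \<mu>\<^sup>2) (1 / \<nu>\<^sup>2))"
  have "p = c + (e \<bullet> (p - c)) *\<^sub>R e + (perp e \<bullet> (p - c)) *\<^sub>R perp e"
    unfolding add.assoc perp_expansion[OF e, of "p - c", symmetric] by simp
  moreover have "(e \<bullet> (p - c) / \<mu>)\<^sup>2 + (perp e \<bullet> (p - c) / \<nu>)\<^sup>2 = 1"
    using p by (simp add: conic_def frame_matrix_quadratic power_divide)
  ultimately show "p \<in> ellipse c e \<mu> \<nu>"
    unfolding ellipse_def by blast
next
  have ee: "e \<bullet> e = 1" "perp e \<bullet> perp e = 1"
    using e by (simp_all add: power2_norm_eq_inner[symmetric])
  fix p assume "p \<in> ellipse c e \<mu> \<nu>"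
  then show "p \<in> conic c (frame_matrix e (1 / \<mu>\<^sup>2) (1 / \<nu>\<^sup>2))"
    unfolding ellipse_def conic_def
    by (auto simp: frame_matrix_quadratic inner_add_right ee power_divide)
qed

lemma (in incenter_triangle) vertex_ne_incenter: "A \<noteq> I" "B \<noteq> I" "C \<noteq> I"
  using incenter pos by (auto simp: sum_power2_eq_zero_iff)

text \<open>\<open>incenter_barycentric\<close> writes \<open>w\<close> as a combination of
  \<open>u\<close> and \<open>v\<close> with nonzero coefficients. Expanding the form at
  \<open>w\<close> therefore leaves only the cross term of \<open>u\<close> and \<open>v\<close>,
  which must vanish as well, and the form is zero on a basis.\<close>

lemma (in incenter_triangle) symmetric_matrix_eq_0:
  fixes D :: "real^2^2"
  assumes sym: "transpose D = D" and "(A - I) \<bullet> (D *v (A - I)) = 0"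
    "(B - I) \<bullet> (D *v (B - I)) = 0" "(C - I) \<bullet> (D *v (C - I)) = 0"
  shows "D = 0"
proof -
  define u v w where uvw: "u = A - I" "v = B - I" "w = C - I"
  have w: "(x + y) *\<^sub>R w = - ((y + z) *\<^sub>R u + (z + x) *\<^sub>R v)"
    using incenter_barycentric unfolding uvw
    by (simp add: add_eq_0_iff2 add.commute)
  have zero: "u \<bullet> (D *v u) = 0" "v \<bullet> (D *v v) = 0" "w \<bullet> (D *v w) = 0"
    using assms unfolding uvw by auto
  have "0 = ((x + y) *\<^sub>R w) \<bullet> (D *v ((x + y) *\<^sub>R w))"
    using zero by (simp add: matrix_vector_mult_scaleR)
  also have "\<dots> = 2 * (y + z) * (z + x) * (u \<bullet> (D *v v))"
    unfolding w using zero symmetric_matrix_inner[OF sym, of v u]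
    by (simp add: matrix_vector_mult_scaleR matrix_vector_right_distrib inner_add_left
        inner_add_right scaleR_minus_left[symmetric] algebra_simps del: scaleR_minus_left)
  finally have uv: "u \<bullet> (D *v v) = 0" "v \<bullet> (D *v u) = 0"
    using pos symmetric_matrix_inner[OF sym, of v u] by auto
  have orth: "p = 0" if "p \<bullet> u = 0" "p \<bullet> v = 0" for p
  proof (rule inner_eq_0_imp_eq_0)
    have "p \<bullet> ((x + y) *\<^sub>R w) = 0"
      unfolding w using that by (simp add: inner_add_right inner_diff_right)
    then have "p \<bullet> w = 0"
      using pos by simp
    then show "p \<bullet> (B - A) = 0" "p \<bullet> (C - A) = 0"
      using that unfolding uvw by (simp_all add: inner_diff_right)
  qed
  have "D *v u = 0" "D *v v = 0"
    by (rule orth; use zero uv in \<open>simp add: inner_commute\<close>)+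
  then have "D *v p = 0" for p
    by (intro orth) (simp_all add: inner_commute[of "D *v p"] symmetric_matrix_inner[OF sym, of _ p])
  then show ?thesis
    by (simp add: matrix_eq)
qed

section \<open>The excentral triangle and its inconic\<close>

locale poristic_triangle = incenter_triangle +
  fixes X\<^sub>3 R
  assumes circum: "dist A X\<^sub>3 = R" "dist B X\<^sub>3 = R" "dist C X\<^sub>3 = R"
begin

text \<open>Minus the power of the incenter with respect to the circumcircle; Euler's formula
  identifies it with \<open>2 * R * r\<close>.\<close>

definition K where "K = R\<^sup>2 - (dist I X\<^sub>3)\<^sup>2"

lemma rotate_poristic: "poristic_triangle B C A I y z x r X\<^sub>3 R"
  using rotate1 circum by (simp add: poristic_triangle_def poristic_triangle_axioms_def)

lemma inner_circumcenter:
  "2 * ((A - I) \<bullet> (X\<^sub>3 - I)) = (A - I) \<bullet> (A - I) - K"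
  "2 * ((B - I) \<bullet> (X\<^sub>3 - I)) = (B - I) \<bullet> (B - I) - K"
  "2 * ((C - I) \<bullet> (X\<^sub>3 - I)) = (C - I) \<bullet> (C - I) - K"
proof -
  have "2 * ((P - I) \<bullet> (X\<^sub>3 - I)) = (P - I) \<bullet> (P - I) + (dist I X\<^sub>3)\<^sup>2 - (dist P X\<^sub>3)\<^sup>2" for P
    unfolding dist_norm power2_norm_eq_inner
    by (simp add: inner_diff_left inner_diff_right inner_commute algebra_simps)
  from this[of A] this[of B] this[of C] show
    "2 * ((A - I) \<bullet> (X\<^sub>3 - I)) = (A - I) \<bullet> (A - I) - K"
    "2 * ((B - I) \<bullet> (X\<^sub>3 - I)) = (B - I) \<bullet> (B - I) - K"
    "2 * ((C - I) \<bullet> (X\<^sub>3 - I)) = (C - I) \<bullet> (C - I) - K"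
    unfolding K_def circum by simp_all
qed

text \<open>Obtained by pairing the barycentric relation of the incenter with
  \<open>X\<^sub>3 - I\<close> and eliminating \<open>r\<close> by \<open>heron\<close>. It shows
  that \<open>K\<close> is positive, so the incenter is inside the circumcircle.\<close>

lemma K_eq: "2 * (x + y + z) * K = (x + y) * (y + z) * (z + x)"
proof -
  have "0 = 2 * (((y + z) *\<^sub>R (A - I) + (z + x) *\<^sub>R (B - I) + (x + y) *\<^sub>R (C - I)) \<bullet> (X\<^sub>3 - I))"
    unfolding incenter_barycentric by simp
  also have "\<dots> = (y + z) * (2 * ((A - I) \<bullet> (X\<^sub>3 - I))) + (z + x) * (2 * ((B - I) \<bullet> (X\<^sub>3 - I)))
      + (x + y) * (2 * ((C - I) \<bullet> (X\<^sub>3 - I)))"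
    unfolding inner_add_left inner_scaleR_left by (simp add: algebra_simps)
  also have "\<dots> = (y + z) * (x\<^sup>2 + r\<^sup>2 - K) + (z + x) * (y\<^sup>2 + r\<^sup>2 - K) + (x + y) * (z\<^sup>2 + r\<^sup>2 - K)"
    unfolding inner_circumcenter incenter ..
  also have "\<dots> = (y + z) * x\<^sup>2 + (z + x) * y\<^sup>2 + (x + y) * z\<^sup>2
      + 2 * (r\<^sup>2 * (x + y + z)) - 2 * (x + y + z) * K"
    by (simp add: algebra_simps)
  finally show ?thesis
    unfolding heron by (simp add: power2_eq_square algebra_simps)
qed

lemma K_pos: "0 < K"
proof -
  have "0 < 2 * (x + y + z) * K"
    unfolding K_eq using pos by simp
  then show ?thesis
    using pos by (simp add: zero_less_mult_iff)
qed

lemma incenter_dist_K: "(y + z) * ((A - I) \<bullet> (A - I)) = 2 * x * K"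
proof -
  have "(x + y + z) * ((y + z) * ((A - I) \<bullet> (A - I))) = (y + z) * (x\<^sup>2 * (x + y + z) + r\<^sup>2 * (x + y + z))"
    unfolding incenter by (simp add: algebra_simps)
  also have "\<dots> = x * ((x + y) * (y + z) * (z + x))"
    unfolding heron by (simp add: power2_eq_square algebra_simps)
  also have "\<dots> = (x + y + z) * (2 * x * K)"
    unfolding K_eq[symmetric] by simp
  finally show ?thesis
    using pos by simp
qed

text \<open>The factor \<open>k = (y + z) / x\<close> satisfies
  \<open>k * |A - I|^2 = 2 * K\<close>. The terms still containing \<open>k\<close> then cancel,
  leaving \<open>4 * d^2 + 4 * K = 4 * R^2\<close> with \<open>d\<close> the distance of the two
  centers.\<close>

lemma dist_excenter: "dist (2 *\<^sub>R X\<^sub>3 - I) (excenter A B C) = 2 * R"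
proof -
  define k where "k = (y + z) / x"
  have kx: "k * ((A - I) \<bullet> (A - I)) = 2 * K"
    using incenter_dist_K pos by (simp add: k_def field_simps)
  have "(dist (2 *\<^sub>R X\<^sub>3 - I) (excenter A B C))\<^sup>2 = (norm (2 *\<^sub>R (X\<^sub>3 - I) + k *\<^sub>R (A - I)))\<^sup>2"
    unfolding excenter_eq k_def[symmetric] dist_norm
    by (rule arg_cong[where f = "\<lambda>v. (norm v)\<^sup>2"]) (simp add: algebra_simps scaleR_2)
  also have "\<dots> = 4 * ((X\<^sub>3 - I) \<bullet> (X\<^sub>3 - I)) + 2 * k * (2 * ((A - I) \<bullet> (X\<^sub>3 - I)))
      + k * (k * ((A - I) \<bullet> (A - I)))"
    unfolding power2_norm_eq_inner inner_add_left inner_add_right inner_scaleR_left inner_scaleR_right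
    by (simp add: inner_commute distrib_left)
  also have "\<dots> = 4 * ((X\<^sub>3 - I) \<bullet> (X\<^sub>3 - I)) + 2 * (k * ((A - I) \<bullet> (A - I)))
      - 2 * k * K + k * (k * ((A - I) \<bullet> (A - I)))"
    unfolding inner_circumcenter by (simp add: algebra_simps)
  also have "\<dots> = (2 * R)\<^sup>2"
    unfolding kx by (simp add: K_def dist_norm norm_minus_commute[of I] power2_norm_eq_inner algebra_simps)
  finally show ?thesis
    using circum(1) by (auto intro: power2_eq_imp_eq[OF _ zero_le_dist])
qed

text \<open>The sidelines of the excentral triangle are the external bisectors, perpendicular to \<open>AI\<close>
  at \<open>A\<close>.\<close>

lemma excenter_on_bisector:
  "(A - I) \<bullet> (excenter B C A - (2 *\<^sub>R X\<^sub>3 - I)) = K" "(A - I) \<bullet> (excenter C A B - (2 *\<^sub>R X\<^sub>3 - I)) = K"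
proof -
  \<comment> \<open>The premise says that the excenter \<open>I - k *\<^sub>R v\<close> projects to
    \<open>A\<close> on the line \<open>AI\<close>; the value \<open>K\<close> then comes from
    \<open>inner_circumcenter\<close>.\<close>
  have shift: "(A - I) \<bullet> (I - k *\<^sub>R v - (2 *\<^sub>R X\<^sub>3 - I)) = K"
    if "- k * ((A - I) \<bullet> v) = (A - I) \<bullet> (A - I)" for k v
  proof -
    have "(A - I) \<bullet> (I - k *\<^sub>R v - (2 *\<^sub>R X\<^sub>3 - I)) = (A - I) \<bullet> (- k *\<^sub>R v - 2 *\<^sub>R (X\<^sub>3 - I))"
      by (rule arg_cong[where f = "(\<bullet>) (A - I)"]) (simp add: algebra_simps scaleR_2)
    also have "\<dots> = - k * ((A - I) \<bullet> v) - 2 * ((A - I) \<bullet> (X\<^sub>3 - I))"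
      by (simp only: inner_diff_right inner_scaleR_right)
    finally show ?thesis
      unfolding that inner_circumcenter by simp
  qed
  have "r\<^sup>2 * z = x * y * z - r\<^sup>2 * x - r\<^sup>2 * y"
    using heron by (simp add: algebra_simps)
  then have "- (z + x) * (r\<^sup>2 - x * y) = y * (x\<^sup>2 + r\<^sup>2)" "- (x + y) * (r\<^sup>2 - z * x) = z * (x\<^sup>2 + r\<^sup>2)"
    by (simp_all add: algebra_simps power2_eq_square)
  then have "- ((z + x) / y) * (r\<^sup>2 - x * y) = x\<^sup>2 + r\<^sup>2" "- ((x + y) / z) * (r\<^sup>2 - z * x) = x\<^sup>2 + r\<^sup>2"
    using pos by (simp_all add: field_simps)
  then show
    "(A - I) \<bullet> (excenter B C A - (2 *\<^sub>R X\<^sub>3 - I)) = K" "(A - I) \<bullet> (excenter C A B - (2 *\<^sub>R X\<^sub>3 - I)) = K"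
    unfolding incenter_triangle.excenter_eq[OF rotate1] incenter_triangle.excenter_eq[OF rotate2]
    by (intro shift; simp add: inner_incenter)+
qed

text \<open>Separates the excenters: each lies strictly on one side of the external bisector
  carrying the other two, so no two coincide and the excentral sidelines are true lines.\<close>

lemma excenter_opposite: "(A - I) \<bullet> (excenter A B C - (2 *\<^sub>R X\<^sub>3 - I)) < K"
proof -
  have A: "0 < (A - I) \<bullet> (A - I)"
    unfolding incenter using pos by (simp add: add_pos_nonneg)
  have "(A - I) \<bullet> (excenter A B C - (2 *\<^sub>R X\<^sub>3 - I))
      = (A - I) \<bullet> (- ((y + z) / x) *\<^sub>R (A - I) - 2 *\<^sub>R (X\<^sub>3 - I))"
    unfolding excenter_eq
    by (rule arg_cong[where f = "(\<bullet>) (A - I)"]) (simp add: algebra_simps scaleR_2)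
  also have "\<dots> = K - (1 + (y + z) / x) * ((A - I) \<bullet> (A - I))"
    unfolding inner_diff_right[of _ "_ *\<^sub>R _"] inner_scaleR_right inner_circumcenter
    by (simp add: algebra_simps)
  also have "\<dots> < K"
  proof -
    have "0 < 1 + (y + z) / x"
      using pos by (simp add: add_pos_pos)
    then show ?thesis
      using mult_pos_pos[OF _ A] by simp
  qed
  finally show ?thesis .
qed

lemma excentral_sideline:
  "line_through (excenter B C A) (excenter C A B) = {p. ((A - I) /\<^sub>R K) \<bullet> (p - (2 *\<^sub>R X\<^sub>3 - I)) = 1}"
proof -
  have ne: "excenter B C A \<noteq> excenter C A B"
    using poristic_triangle.excenter_on_bisector(1)[OF rotate_poristic]
      poristic_triangle.excenter_opposite[OF rotate_poristic]
    by (metis less_irrefl)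
  have "line_through (excenter B C A) (excenter C A B)
      = {p. (A - I) \<bullet> p = K + (A - I) \<bullet> (2 *\<^sub>R X\<^sub>3 - I)}"
  proof (rule line_through_eq_hyperplane[OF ne])
    show "A - I \<noteq> 0"
      using vertex_ne_incenter by simp
    show "(A - I) \<bullet> excenter B C A = K + (A - I) \<bullet> (2 *\<^sub>R X\<^sub>3 - I)"
      using excenter_on_bisector(1) unfolding inner_diff_right[of _ "excenter _ _ _"] by linarith
    show "(A - I) \<bullet> excenter C A B = K + (A - I) \<bullet> (2 *\<^sub>R X\<^sub>3 - I)"
      using excenter_on_bisector(2) unfolding inner_diff_right[of _ "excenter _ _ _"] by linarith
  qed
  moreover have "(A - I) \<bullet> p = K + (A - I) \<bullet> q \<longleftrightarrow> ((A - I) /\<^sub>R K) \<bullet> (p - q) = 1" for p q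
    using K_pos unfolding inner_scaleR_left inner_diff_right by (auto simp: field_simps)
  ultimately show ?thesis
    by simp
qed

lemma circumcenter_excentral: "circumcenter (excentral (A, B, C)) = 2 *\<^sub>R X\<^sub>3 - I"
proof -
  define a b c where abc: "a = excenter A B C" "b = excenter B C A" "c = excenter C A B"
  note r1 = rotate_poristic
  note r2 = poristic_triangle.rotate_poristic[OF rotate_poristic]
  have d: "dist (2 *\<^sub>R X\<^sub>3 - I) a = 2 * R" "dist (2 *\<^sub>R X\<^sub>3 - I) b = 2 * R" "dist (2 *\<^sub>R X\<^sub>3 - I) c = 2 * R"
    unfolding abc using dist_excenter poristic_triangle.dist_excenter[OF r1]
      poristic_triangle.dist_excenter[OF r2] by auto
  have ex: "a = I - ((y + z) / x) *\<^sub>R (A - I)" "b = I - ((z + x) / y) *\<^sub>R (B - I)"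
    "c = I - ((x + y) / z) *\<^sub>R (C - I)"
    unfolding abc using excenter_eq incenter_triangle.excenter_eq[OF rotate1]
      incenter_triangle.excenter_eq[OF rotate2] by auto
  have "R \<noteq> 0"
    using K_pos by (auto simp: K_def)
  then have "0 < R"
    using circum(1) by (metis zero_le_dist order_le_less)
  \<comment> \<open>A second center, displaced by \<open>e\<close>, would make \<open>e\<close> have
    equal inner products \<open>h\<close> with all three vectors from \<open>I\<close> to the
    excenters. The excenter formulas and the barycentric relation give
    \<open>(x + y + z) * h = 0\<close>, hence \<open>e = 0\<close>.\<close>
  have unique: "p = 2 *\<^sub>R X\<^sub>3 - I" if p: "dist p a = \<rho>" "dist p b = \<rho>" "dist p c = \<rho>" for p \<rho>
  proof -
    define e where "e = p - (2 *\<^sub>R X\<^sub>3 - I)"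
    have diff: "(dist p q)\<^sup>2 - (dist (2 *\<^sub>R X\<^sub>3 - I) q)\<^sup>2 = p \<bullet> p - (2 *\<^sub>R X\<^sub>3 - I) \<bullet> (2 *\<^sub>R X\<^sub>3 - I) - 2 * (e \<bullet> q)" for q
      unfolding dist_norm power2_norm_eq_inner e_def
      by (simp add: inner_diff_left inner_diff_right inner_commute algebra_simps)
    define h where "h = e \<bullet> (a - I)"
    have h: "e \<bullet> (a - I) = h" "e \<bullet> (b - I) = h" "e \<bullet> (c - I) = h"
      using diff[of a] diff[of b] diff[of c] unfolding d p h_def inner_diff_right by simp_all
    have exe: "(y + z) * (e \<bullet> (A - I)) = - (x * h)" "(z + x) * (e \<bullet> (B - I)) = - (y * h)"
      "(x + y) * (e \<bullet> (C - I)) = - (z * h)"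
    proof -
      have *: "e \<bullet> (I - k *\<^sub>R v - I) = - (k * (e \<bullet> v))" for k v
        by simp
      note he = h[unfolded ex *]
      show "(y + z) * (e \<bullet> (A - I)) = - (x * h)" "(z + x) * (e \<bullet> (B - I)) = - (y * h)"
        "(x + y) * (e \<bullet> (C - I)) = - (z * h)"
        using he pos by (simp_all add: field_simps)
    qed
    have "0 = e \<bullet> ((y + z) *\<^sub>R (A - I) + (z + x) *\<^sub>R (B - I) + (x + y) *\<^sub>R (C - I))"
      unfolding incenter_barycentric by simp
    also have "\<dots> = - (x * h + y * h + z * h)"
      unfolding inner_add_right inner_scaleR_right exe by simp
    finally have "(x + y + z) * h = 0"
      by (simp add: algebra_simps)
    then have "h = 0"
      using pos by simp
    then have "e \<bullet> (A - I) = 0" "e \<bullet> (B - I) = 0" "e \<bullet> (C - I) = 0"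
      using exe pos by auto
    then have "e = 0"
      by (intro inner_eq_0_imp_eq_0) (simp_all add: inner_diff_right)
    then show ?thesis by (simp add: e_def)
  qed
  show ?thesis
    unfolding circumcenter_def excentral.simps abc[symmetric]
  proof (rule the_equality)
    show "\<exists>\<rho>. is_circumcircle (a, b, c) (2 *\<^sub>R X\<^sub>3 - I) \<rho>"
      using d \<open>0 < R\<close> by (intro exI[of _ "2 * R"]) simp
  qed (auto intro: unique)
qed

lemma is_inconic_excentral_iff:
  "is_inconic (excentral (A, B, C)) (2 *\<^sub>R X\<^sub>3 - I) E \<longleftrightarrow>
    (\<exists>M N. transpose M = M \<and> N ** M = mat 1 \<and> M ** N = mat 1 \<and> E = conic (2 *\<^sub>R X\<^sub>3 - I) M \<and>
      (\<forall>P\<in>{A, B, C}. (P - I) \<bullet> (N *v (P - I)) = K\<^sup>2))"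
proof -
  have tangent: "conic_tangent (2 *\<^sub>R X\<^sub>3 - I) M {p. ((P - I) /\<^sub>R K) \<bullet> (p - (2 *\<^sub>R X\<^sub>3 - I)) = 1} \<longleftrightarrow>
      (P - I) \<bullet> (N *v (P - I)) = K\<^sup>2"
    if "transpose M = M" "N ** M = mat 1" "M ** N = mat 1" "P \<in> {A, B, C}" for M N P
  proof -
    have "(P - I) /\<^sub>R K \<noteq> 0"
      using K_pos vertex_ne_incenter that(4) by auto
    moreover have "inverse K * (inverse K * t) = 1 \<longleftrightarrow> t = K\<^sup>2" for t
      using K_pos by (auto simp: power2_eq_square field_simps)
    ultimately show ?thesis
      by (subst conic_tangent_iff_dual[OF that(1-3)])
        (simp_all only: matrix_vector_mult_scaleR inner_scaleR_left inner_scaleR_right simp_thms)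
  qed
  have lines: "line_through (excenter C A B) (excenter A B C) = {p. ((B - I) /\<^sub>R K) \<bullet> (p - (2 *\<^sub>R X\<^sub>3 - I)) = 1}"
    "line_through (excenter A B C) (excenter B C A) = {p. ((C - I) /\<^sub>R K) \<bullet> (p - (2 *\<^sub>R X\<^sub>3 - I)) = 1}"
    using poristic_triangle.excentral_sideline[OF rotate_poristic]
      poristic_triangle.excentral_sideline[OF poristic_triangle.rotate_poristic[OF rotate_poristic]]
    by blast+
  show ?thesis
    unfolding excentral.simps is_inconic.simps excentral_sideline lines invertible_def
  proof (intro iffI; elim exE conjE)
    fix M N
    assume M: "transpose M = M" "E = conic (2 *\<^sub>R X\<^sub>3 - I) M" "M ** N = mat 1" "N ** M = mat 1"
      and T: "conic_tangent (2 *\<^sub>R X\<^sub>3 - I) M {p. ((A - I) /\<^sub>R K) \<bullet> (p - (2 *\<^sub>R X\<^sub>3 - I)) = 1}"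
        "conic_tangent (2 *\<^sub>R X\<^sub>3 - I) M {p. ((B - I) /\<^sub>R K) \<bullet> (p - (2 *\<^sub>R X\<^sub>3 - I)) = 1}"
        "conic_tangent (2 *\<^sub>R X\<^sub>3 - I) M {p. ((C - I) /\<^sub>R K) \<bullet> (p - (2 *\<^sub>R X\<^sub>3 - I)) = 1}"
    have "\<forall>P\<in>{A, B, C}. (P - I) \<bullet> (N *v (P - I)) = K\<^sup>2"
      using tangent[OF M(1) M(4) M(3)] T by blast
    then show "\<exists>M N. transpose M = M \<and> N ** M = mat 1 \<and> M ** N = mat 1 \<and> E = conic (2 *\<^sub>R X\<^sub>3 - I) M \<and>
      (\<forall>P\<in>{A, B, C}. (P - I) \<bullet> (N *v (P - I)) = K\<^sup>2)"
      using M by blast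
  next
    fix M N
    assume M: "transpose M = M" "N ** M = mat 1" "M ** N = mat 1" "E = conic (2 *\<^sub>R X\<^sub>3 - I) M"
      and N: "\<forall>P\<in>{A, B, C}. (P - I) \<bullet> (N *v (P - I)) = K\<^sup>2"
    have "conic_tangent (2 *\<^sub>R X\<^sub>3 - I) M {p. ((P - I) /\<^sub>R K) \<bullet> (p - (2 *\<^sub>R X\<^sub>3 - I)) = 1}"
      if "P \<in> {A, B, C}" for P
      using tangent[OF M(1-3) that] N that by blast
    then show "\<exists>M. transpose M = M \<and> (\<exists>N. M ** N = mat 1 \<and> N ** M = mat 1) \<and>
        E = conic (2 *\<^sub>R X\<^sub>3 - I) M \<and>
        conic_tangent (2 *\<^sub>R X\<^sub>3 - I) M {p. ((A - I) /\<^sub>R K) \<bullet> (p - (2 *\<^sub>R X\<^sub>3 - I)) = 1} \<and>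
        conic_tangent (2 *\<^sub>R X\<^sub>3 - I) M {p. ((B - I) /\<^sub>R K) \<bullet> (p - (2 *\<^sub>R X\<^sub>3 - I)) = 1} \<and>
        conic_tangent (2 *\<^sub>R X\<^sub>3 - I) M {p. ((C - I) /\<^sub>R K) \<bullet> (p - (2 *\<^sub>R X\<^sub>3 - I)) = 1}"
      using M by blast
  qed
qed

text \<open>The competing conic may be any central one, hyperbolas included: uniqueness compares the
  inverse matrices, where the three conditions are linear, and needs no definiteness.\<close>

lemma inconic_excentral_eq:
  assumes e: "norm e = 1" and "\<mu> \<noteq> 0" "\<nu> \<noteq> 0"
    and q: "\<And>P. P \<in> {A, B, C} \<Longrightarrow> \<mu>\<^sup>2 * (e \<bullet> (P - I))\<^sup>2 + \<nu>\<^sup>2 * (perp e \<bullet> (P - I))\<^sup>2 = K\<^sup>2"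
  shows "inconic (excentral (A, B, C)) (2 *\<^sub>R X\<^sub>3 - I) = ellipse (2 *\<^sub>R X\<^sub>3 - I) e \<mu> \<nu>"
proof -
  define M\<^sub>0 N\<^sub>0 where MN: "M\<^sub>0 = frame_matrix e (1 / \<mu>\<^sup>2) (1 / \<nu>\<^sup>2)" "N\<^sub>0 = frame_matrix e (\<mu>\<^sup>2) (\<nu>\<^sup>2)"
  have inv: "N\<^sub>0 ** M\<^sub>0 = mat 1" "M\<^sub>0 ** N\<^sub>0 = mat 1"
    using frame_matrix_inverse[OF e, of "\<mu>\<^sup>2" "\<nu>\<^sup>2"] assms(2,3)
    by (simp_all add: MN matrix_left_right_inverse)
  have sym: "transpose M\<^sub>0 = M\<^sub>0" "transpose N\<^sub>0 = N\<^sub>0"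
    by (simp_all add: MN transpose_frame_matrix)
  have N\<^sub>0: "(P - I) \<bullet> (N\<^sub>0 *v (P - I)) = K\<^sup>2" if "P \<in> {A, B, C}" for P
    using q[OF that] by (simp add: MN frame_matrix_quadratic)
  have "inconic (excentral (A, B, C)) (2 *\<^sub>R X\<^sub>3 - I) = conic (2 *\<^sub>R X\<^sub>3 - I) M\<^sub>0"
    unfolding inconic_def
  proof (rule the_equality)
    show "is_inconic (excentral (A, B, C)) (2 *\<^sub>R X\<^sub>3 - I) (conic (2 *\<^sub>R X\<^sub>3 - I) M\<^sub>0)"
      unfolding is_inconic_excentral_iff using inv sym N\<^sub>0 by blast
  next
    fix E assume "is_inconic (excentral (A, B, C)) (2 *\<^sub>R X\<^sub>3 - I) E"
    then obtain M N where M: "transpose M = M" "N ** M = mat 1" "M ** N = mat 1"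
      "E = conic (2 *\<^sub>R X\<^sub>3 - I) M"
      and N: "\<And>P. P \<in> {A, B, C} \<Longrightarrow> (P - I) \<bullet> (N *v (P - I)) = K\<^sup>2"
      unfolding is_inconic_excentral_iff by blast
    \<comment> \<open>Only \<open>M\<close> is assumed symmetric. Its inverse \<open>N\<close> is
      symmetric too, because \<open>transpose N\<close> is another left inverse.\<close>
    have "transpose N ** M = mat 1"
      using arg_cong[OF M(3), of transpose] M(1) by (simp add: matrix_transpose_mul)
    then have "transpose N = N"
      by (metis M(3) matrix_mul_assoc matrix_mul_lid matrix_mul_rid)
    then have "transpose (N - N\<^sub>0) = N - N\<^sub>0"
      using sym(2) by (simp add: transpose_def vec_eq_iff)
    then have "N - N\<^sub>0 = 0"
      by (rule symmetric_matrix_eq_0)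
        (simp_all add: matrix_vector_mult_diff_rdistrib inner_diff_right N N\<^sub>0)
    then have "M = M\<^sub>0"
      using M(3) inv(1) by (metis eq_iff_diff_eq_0 matrix_mul_assoc matrix_mul_lid matrix_mul_rid)
    then show "E = conic (2 *\<^sub>R X\<^sub>3 - I) M\<^sub>0"
      using M(4) by simp
  qed
  then show ?thesis
    by (simp add: MN conic_frame_matrix_eq_ellipse[OF e])
qed

end

section \<open>Semiaxes and rotations of ellipses\<close>

lemma is_ellipse_iff:
  "is_ellipse E c \<mu> \<nu> \<longleftrightarrow> 0 < \<nu> \<and> \<nu> \<le> \<mu> \<and> (\<exists>e. norm e = 1 \<and> E = ellipse c e \<mu> \<nu>)"
proof
  assume E: "is_ellipse E c \<mu> \<nu>"
  then obtain u v where uv: "norm u = 1" "norm v = 1" "orthogonal u v"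
    and Euv: "E = {c + x *\<^sub>R u + y *\<^sub>R v | x y. (x / \<mu>)\<^sup>2 + (y / \<nu>)\<^sup>2 = 1}"
    unfolding is_ellipse_def by blast
  consider "v = perp u" | "v = - perp u"
    using orthogonal_imp_perp[OF uv] by blast
  then have "E = ellipse c u \<mu> \<nu>"
  proof cases
    case 1
    then show ?thesis by (simp add: Euv ellipse_def)
  next
    \<comment> \<open>The second axis points the other way; replacing \<open>y\<close> by
      \<open>- y\<close> preserves the equation.\<close>
    case 2
    have "(\<exists>x y. p = c + x *\<^sub>R u + y *\<^sub>R v \<and> (x / \<mu>)\<^sup>2 + (y / \<nu>)\<^sup>2 = 1) \<longleftrightarrow>
        (\<exists>x y. p = c + x *\<^sub>R u + y *\<^sub>R perp u \<and> (x / \<mu>)\<^sup>2 + (y / \<nu>)\<^sup>2 = 1)" (is "?P \<longleftrightarrow> ?Q") for p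
    proof
      assume ?P
      then obtain x y where "p = c + x *\<^sub>R u + (- y) *\<^sub>R perp u" "(x / \<mu>)\<^sup>2 + (- y / \<nu>)\<^sup>2 = 1"
        using 2 by auto
      then show ?Q by blast
    next
      assume ?Q
      then obtain x y where "p = c + x *\<^sub>R u + (- y) *\<^sub>R v" "(x / \<mu>)\<^sup>2 + (- y / \<nu>)\<^sup>2 = 1"
        using 2 by auto
      then show ?P by blast
    qed
    then show ?thesis
      unfolding Euv ellipse_def by blast
  qed
  then show "0 < \<nu> \<and> \<nu> \<le> \<mu> \<and> (\<exists>e. norm e = 1 \<and> E = ellipse c e \<mu> \<nu>)"
    using E uv unfolding is_ellipse_def by blast
next
  assume "0 < \<nu> \<and> \<nu> \<le> \<mu> \<and> (\<exists>e. norm e = 1 \<and> E = ellipse c e \<mu> \<nu>)"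
  then obtain e where "0 < \<nu>" "\<nu> \<le> \<mu>" "norm e = 1" "E = ellipse c e \<mu> \<nu>"
    by blast
  then show "is_ellipse E c \<mu> \<nu>"
    unfolding is_ellipse_def ellipse_def
    by (intro conjI exI[of _ e] exI[of _ "perp e"]) (simp_all add: orthogonal_def)
qed

text \<open>The semiaxes will be recovered from the point set alone, as the extreme distances from
  the center; this makes them unique.\<close>

lemma ellipse_dist_bounds:
  assumes e: "norm e = 1" and "0 < \<nu>" "\<nu> \<le> \<mu>" and p: "p \<in> ellipse c e \<mu> \<nu>"
  shows "\<nu> \<le> dist c p" "dist c p \<le> \<mu>"
proof -
  obtain x y where xy: "p = c + x *\<^sub>R e + y *\<^sub>R perp e" "(x / \<mu>)\<^sup>2 + (y / \<nu>)\<^sup>2 = 1"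
    using p unfolding ellipse_def by blast
  define s t where st: "s = x / \<mu>" "t = y / \<nu>"
  have x: "x = \<mu> * s" "y = \<nu> * t" and st1: "s\<^sup>2 + t\<^sup>2 = 1"
    using xy assms(2,3) by (auto simp: st)
  have ee: "e \<bullet> e = 1" "perp e \<bullet> perp e = 1"
    using e by (simp_all add: power2_norm_eq_inner[symmetric])
  have "(dist c p)\<^sup>2 = (norm (x *\<^sub>R e + y *\<^sub>R perp e))\<^sup>2"
    unfolding xy(1) dist_norm by (subst norm_minus_commute) (simp add: algebra_simps)
  also have "\<dots> = x\<^sup>2 + y\<^sup>2"
    unfolding power2_norm_eq_inner by (simp add: inner_add_left inner_add_right ee power2_eq_square)
  finally have d: "(dist c p)\<^sup>2 = \<mu>\<^sup>2 * s\<^sup>2 + \<nu>\<^sup>2 * t\<^sup>2"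
    by (simp add: x power_mult_distrib)
  have le: "\<nu>\<^sup>2 \<le> \<mu>\<^sup>2"
    using assms(2,3) by (simp add: power_mono)
  have "\<nu>\<^sup>2 = \<nu>\<^sup>2 * s\<^sup>2 + \<nu>\<^sup>2 * t\<^sup>2" "\<mu>\<^sup>2 = \<mu>\<^sup>2 * s\<^sup>2 + \<mu>\<^sup>2 * t\<^sup>2"
    by (simp_all add: distrib_left[symmetric] st1)
  moreover have "\<nu>\<^sup>2 * s\<^sup>2 \<le> \<mu>\<^sup>2 * s\<^sup>2" "\<nu>\<^sup>2 * t\<^sup>2 \<le> \<mu>\<^sup>2 * t\<^sup>2"
    using le by (simp_all add: mult_right_mono)
  ultimately have "\<nu>\<^sup>2 \<le> (dist c p)\<^sup>2" "(dist c p)\<^sup>2 \<le> \<mu>\<^sup>2"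
    unfolding d by linarith+
  then show "\<nu> \<le> dist c p" "dist c p \<le> \<mu>"
    using assms(2,3) by (auto intro: power2_le_imp_le)
qed

lemma ellipse_vertices:
  assumes "norm e = 1" "0 < \<nu>" "\<nu> \<le> \<mu>"
  shows "\<exists>p\<in>ellipse c e \<mu> \<nu>. dist c p = \<mu>" "\<exists>p\<in>ellipse c e \<mu> \<nu>. dist c p = \<nu>"
proof -
  have "c + \<mu> *\<^sub>R e + 0 *\<^sub>R perp e \<in> ellipse c e \<mu> \<nu>" "c + 0 *\<^sub>R e + \<nu> *\<^sub>R perp e \<in> ellipse c e \<mu> \<nu>"
    unfolding ellipse_def using assms
    by (intro CollectI exI[of _ \<mu>] exI[of _ 0]; simp)
      (intro CollectI exI[of _ 0] exI[of _ \<nu>]; use assms in simp)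
  moreover have "dist c (c + \<mu> *\<^sub>R e + 0 *\<^sub>R perp e) = \<mu>" "dist c (c + 0 *\<^sub>R e + \<nu> *\<^sub>R perp e) = \<nu>"
    using assms by (simp_all add: dist_norm)
  ultimately show "\<exists>p\<in>ellipse c e \<mu> \<nu>. dist c p = \<mu>" "\<exists>p\<in>ellipse c e \<mu> \<nu>. dist c p = \<nu>"
    by blast+
qed

lemma is_ellipse_semiaxes_unique:
  assumes "is_ellipse E c \<mu> \<nu>" "is_ellipse E c \<mu>' \<nu>'"
  shows "\<mu> = \<mu>'" "\<nu> = \<nu>'"
proof -
  have le: "\<mu> \<le> \<mu>'" "\<nu>' \<le> \<nu>" if "is_ellipse E c \<mu> \<nu>" "is_ellipse E c \<mu>' \<nu>'" for \<mu> \<nu> \<mu>' \<nu>'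
    using that ellipse_dist_bounds ellipse_vertices unfolding is_ellipse_iff by metis+
  show "\<mu> = \<mu>'" "\<nu> = \<nu>'"
    using le[OF assms] le[OF assms(2,1)] by auto
qed

lemma rotation_of_ellipse:
  assumes e: "norm e = 1" "norm e' = 1"
  shows "\<exists>Q. rotation_matrix Q \<and> ellipse c e' \<mu> \<nu> = rotate_about c Q ` ellipse c e \<mu> \<nu>"
proof -
  \<comment> \<open>In complex terms \<open>a + b i\<close> is \<open>e' / e\<close>, and
    \<open>Q\<close> is multiplication by it. It commutes with \<open>perp\<close>, so it carries
    the whole frame of \<open>e\<close> to that of \<open>e'\<close>.\<close>
  define a b where ab: "a = e \<bullet> e'" "b = perp e \<bullet> e'"
  define Q :: "real^2^2" where "Q = vector [vector [a, - b], vector [b, a]]"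
  have e': "e' = a *\<^sub>R e + b *\<^sub>R perp e"
    unfolding ab by (rule perp_expansion[OF e(1)])
  have "e' \<bullet> e' = 1" "e \<bullet> e = 1" "perp e \<bullet> perp e = 1"
    using e by (simp_all add: power2_norm_eq_inner[symmetric])
  then have ab1: "a * a + b * b = 1"
    unfolding e' by (simp add: inner_add_left inner_add_right)
  have "rotation_matrix Q"
    unfolding rotation_matrix_def orthogonal_matrix det_2
    by (simp add: Q_def vec_eq_iff forall_2 matrix_matrix_mult_def transpose_def mat_def sum_2 ab1
        add.commute[of "b * b"])
  moreover have Q: "Q *v w = a *\<^sub>R w + b *\<^sub>R perp w" for w
    by (simp add: Q_def vec_eq_iff2 matrix_vector_mult_def sum_2)
  have Qe: "Q *v e = e'"
    by (simp add: Q e')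
  have "Q *v perp e = perp e'"
    unfolding e' Q by (simp add: vec_eq_iff2)
  then have R: "rotate_about c Q (c + x *\<^sub>R e + y *\<^sub>R perp e) = c + x *\<^sub>R e' + y *\<^sub>R perp e'" for x y
    using Qe by (simp add: rotate_about_def add.assoc matrix_vector_right_distrib matrix_vector_mult_scaleR)
  have "ellipse c e' \<mu> \<nu> = rotate_about c Q ` ellipse c e \<mu> \<nu>"
  proof (intro set_eqI iffI)
    fix p assume "p \<in> ellipse c e' \<mu> \<nu>"
    then obtain x y where xy: "p = rotate_about c Q (c + x *\<^sub>R e + y *\<^sub>R perp e)"
      "(x / \<mu>)\<^sup>2 + (y / \<nu>)\<^sup>2 = 1"
      unfolding ellipse_def R by blast
    then show "p \<in> rotate_about c Q ` ellipse c e \<mu> \<nu>"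
      unfolding ellipse_def by blast
  next
    fix p assume "p \<in> rotate_about c Q ` ellipse c e \<mu> \<nu>"
    then obtain x y where "p = c + x *\<^sub>R e' + y *\<^sub>R perp e'" "(x / \<mu>)\<^sup>2 + (y / \<nu>)\<^sup>2 = 1"
      unfolding ellipse_def R[symmetric] by blast
    then show "p \<in> ellipse c e' \<mu> \<nu>"
      unfolding ellipse_def by blast
  qed
  ultimately show ?thesis by blast
qed

section \<open>Complex coordinates and angle bisectors at points of a circle\<close>

definition to_complex :: "real^2 \<Rightarrow> complex" where
  "to_complex v = Complex (v$1) (v$2)"

lemma to_complex_simps [simp]:
  "to_complex (v + w) = to_complex v + to_complex w"
  "to_complex (v - w) = to_complex v - to_complex w"
  "to_complex (k *\<^sub>R v) = of_real k * to_complex v"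
  "to_complex v = to_complex w \<longleftrightarrow> v = w"
  "cmod (to_complex v) = norm v"
  by (auto simp: to_complex_def complex_eq_iff vec_eq_iff2 cmod_def norm_eq_sqrt_inner inner_real2
      power2_eq_square)

lemma mult_cnj_to_complex: "to_complex v * cnj (to_complex v) = (of_real (norm v))\<^sup>2"
  by (simp add: complex_norm_square[symmetric])

text \<open>On a circle centered at the origin the endpoints determine the direction of their chord.
  This allows the conjugate of a chord to be traded for the chord itself.\<close>

lemma chord_cnj:
  fixes z w :: complex
  assumes "z * cnj z = \<rho>" "w * cnj w = \<rho>"
  shows "z * w * cnj (w - z) = - \<rho> * (w - z)"
  unfolding assms(1)[symmetric] using assms by (simp add: algebra_simps)

text \<open>The hypothesis \<open>bis\<close> says that \<open>i\<close> lies on one of the two bisectors at \<open>z\<^sub>1\<close>.\<close>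

lemma circle_bisector:
  fixes z\<^sub>1 z\<^sub>2 z\<^sub>3 i :: complex
  assumes circle: "z\<^sub>1 * cnj z\<^sub>1 = \<rho>" "z\<^sub>2 * cnj z\<^sub>2 = \<rho>" "z\<^sub>3 * cnj z\<^sub>3 = \<rho>"
    and "\<rho> \<noteq> 0" "z\<^sub>2 \<noteq> z\<^sub>1" "z\<^sub>3 \<noteq> z\<^sub>1"
    and bis: "(i - z\<^sub>1)\<^sup>2 * cnj ((z\<^sub>2 - z\<^sub>1) * (z\<^sub>3 - z\<^sub>1)) \<in> \<real>"
  shows "(z\<^sub>1 - i)\<^sup>2 * cnj (z\<^sub>2 * z\<^sub>3) = (cnj i * z\<^sub>1 - \<rho>)\<^sup>2"
proof -
  define p q where pq: "p = z\<^sub>2 - z\<^sub>1" "q = z\<^sub>3 - z\<^sub>1"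
  have p: "z\<^sub>1 * z\<^sub>2 * cnj p = - \<rho> * p" and q: "z\<^sub>1 * z\<^sub>3 * cnj q = - \<rho> * q"
    unfolding pq using chord_cnj circle by blast+
  have b: "(i - z\<^sub>1)\<^sup>2 * (cnj p * cnj q) = (cnj (i - z\<^sub>1))\<^sup>2 * (p * q)"
    using bis unfolding Reals_cnj_iff pq[symmetric] by simp
  \<comment> \<open>Multiplying by \<open>z\<^sub>1\<^sup>2 * z\<^sub>2 * z\<^sub>3\<close> makes
    \<open>chord_cnj\<close> applicable to both chords, after which \<open>p * q\<close>
    cancels.\<close>
  have "(i - z\<^sub>1)\<^sup>2 * ((z\<^sub>1 * z\<^sub>2 * cnj p) * (z\<^sub>1 * z\<^sub>3 * cnj q)) =
      (z\<^sub>1 * cnj (i - z\<^sub>1))\<^sup>2 * (z\<^sub>2 * z\<^sub>3) * (p * q)"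
    using b by algebra
  then have "(p * q) * ((i - z\<^sub>1)\<^sup>2 * \<rho>\<^sup>2) = (p * q) * ((z\<^sub>1 * cnj (i - z\<^sub>1))\<^sup>2 * (z\<^sub>2 * z\<^sub>3))"
    unfolding p q by (simp add: algebra_simps power2_eq_square)
  then have "(i - z\<^sub>1)\<^sup>2 * \<rho>\<^sup>2 = (z\<^sub>1 * cnj (i - z\<^sub>1))\<^sup>2 * (z\<^sub>2 * z\<^sub>3)"
    using assms(5,6) by (simp add: pq)
  moreover have "z\<^sub>1 * cnj (i - z\<^sub>1) = cnj i * z\<^sub>1 - \<rho>"
    unfolding circle(1)[symmetric] by (simp add: algebra_simps)
  ultimately have "(i - z\<^sub>1)\<^sup>2 * \<rho>\<^sup>2 * cnj (z\<^sub>2 * z\<^sub>3)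
      = (cnj i * z\<^sub>1 - \<rho>)\<^sup>2 * ((z\<^sub>2 * cnj z\<^sub>2) * (z\<^sub>3 * cnj z\<^sub>3))"
    by simp
  then have "\<rho>\<^sup>2 * ((i - z\<^sub>1)\<^sup>2 * cnj (z\<^sub>2 * z\<^sub>3)) = \<rho>\<^sup>2 * (cnj i * z\<^sub>1 - \<rho>)\<^sup>2"
    unfolding circle by (simp add: algebra_simps power2_eq_square)
  then show ?thesis
    using assms(4) by (simp add: power2_commute[of i])
qed

text \<open>A positive multiple of \<open>I - A\<close> is \<open>a * p + b * q\<close>, where
  \<open>p\<close> has length \<open>b\<close> and \<open>q\<close> has length \<open>a\<close>. The
  two summands are equally long, so their sum bisects the angle.\<close>

lemma (in incenter_triangle) incenter_on_bisector:
  "(to_complex I - to_complex A)\<^sup>2 *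
    cnj ((to_complex B - to_complex A) * (to_complex C - to_complex A)) \<in> \<real>"
proof -
  define g p q where gpq: "g = to_complex (I - A)" "p = to_complex (B - A)" "q = to_complex (C - A)"
  define a b s where abs: "a = complex_of_real (z + x)" "b = complex_of_real (x + y)"
    "s = complex_of_real (2 * (x + y + z))"
  have "(2 * (x + y + z)) *\<^sub>R (I - A) = (z + x) *\<^sub>R (B - A) + (x + y) *\<^sub>R (C - A)"
    using incenter_barycentric by (simp add: vec_eq_iff2 algebra_simps)
  then have g: "s * g = a * p + b * q"
    unfolding gpq abs by (metis to_complex_simps(1,3))
  have pq: "p * cnj p = b\<^sup>2" "q * cnj q = a\<^sup>2"
    using sides unfolding gpq mult_cnj_to_complex abs by (simp_all add: dist_norm norm_minus_commute)
  have "s\<^sup>2 * (g\<^sup>2 * (cnj p * cnj q)) = (a * b)\<^sup>2 * (p * cnj q + q * cnj p) + 2 * (a * b) ^ 3"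
    using g pq by algebra
  moreover have "p * cnj q + q * cnj p \<in> \<real>"
    by (simp add: Reals_cnj_iff add.commute mult.commute)
  ultimately have "s\<^sup>2 * (g\<^sup>2 * (cnj p * cnj q)) \<in> \<real>"
    by (simp add: abs)
  moreover have "s\<^sup>2 \<in> \<real>" "s\<^sup>2 \<noteq> 0"
    using pos by (auto simp: abs simp del: of_real_add)
  ultimately have "g\<^sup>2 * (cnj p * cnj q) \<in> \<real>"
    by (metis Reals_divide nonzero_mult_div_cancel_left)
  then show ?thesis
    by (simp add: gpq)
qed

lemma (in incenter_triangle) vertices_distinct: "A \<noteq> B" "B \<noteq> C" "C \<noteq> A"
  using sides pos by auto

text \<open>\<open>axis\<close> is unchanged when the vertices are permuted, so the same
  \<open>e\<close> serves \<open>B\<close> and \<open>C\<close>. With \<open>w = A - I\<close>,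
  multiplying the bisector identity by \<open>i * cnj z\<^sub>1\<close> makes the real part affine
  in \<open>c\<close>, the inner product of \<open>I - X\<^sub>3\<close> and
  \<open>A - X\<^sub>3\<close>; so is the squared length of \<open>w\<close>.\<close>

lemma (in poristic_triangle) vertex_quadratic_form:
  fixes e :: "real^2"
  assumes e: "norm e = 1"
    and axis: "of_real (R ^ 3 * dist I X\<^sub>3) * (to_complex e)\<^sup>2 = cnj (to_complex (I - X\<^sub>3)) *
      (to_complex (A - X\<^sub>3) * to_complex (B - X\<^sub>3) * to_complex (C - X\<^sub>3))"
  shows "(R + dist I X\<^sub>3)\<^sup>2 * (e \<bullet> (A - I))\<^sup>2 + (R - dist I X\<^sub>3)\<^sup>2 * (perp e \<bullet> (A - I))\<^sup>2 = K\<^sup>2"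
proof -
  define d where "d = dist I X\<^sub>3"
  define i where "i = to_complex (I - X\<^sub>3)"
  define z\<^sub>1 z\<^sub>2 z\<^sub>3 where z: "z\<^sub>1 = to_complex (A - X\<^sub>3)" "z\<^sub>2 = to_complex (B - X\<^sub>3)" "z\<^sub>3 = to_complex (C - X\<^sub>3)"
  define \<epsilon> where "\<epsilon> = to_complex e"
  define w where "w = to_complex (A - I)"
  define c where "c = Re (cnj i * z\<^sub>1)"
  have R: "R \<noteq> 0"
    using K_pos by (auto simp: K_def)
  have w: "w = z\<^sub>1 - i"
    by (simp add: w_def z i_def)
  have zz: "z\<^sub>1 * cnj z\<^sub>1 = of_real (R\<^sup>2)" "z\<^sub>2 * cnj z\<^sub>2 = of_real (R\<^sup>2)" "z\<^sub>3 * cnj z\<^sub>3 = of_real (R\<^sup>2)"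
    and ii: "i * cnj i = of_real (d\<^sup>2)"
    using circum unfolding z i_def mult_cnj_to_complex d_def by (simp_all add: dist_norm)
  have chord: "w\<^sup>2 * cnj (z\<^sub>2 * z\<^sub>3) = (cnj i * z\<^sub>1 - of_real (R\<^sup>2))\<^sup>2"
    unfolding w
  proof (rule circle_bisector[OF zz])
    show "(i - z\<^sub>1)\<^sup>2 * cnj ((z\<^sub>2 - z\<^sub>1) * (z\<^sub>3 - z\<^sub>1)) \<in> \<real>"
      using incenter_on_bisector by (simp add: z i_def)
  qed (use R vertices_distinct in \<open>auto simp: z\<close>)
  have "of_real (R ^ 3 * d) * ((cnj \<epsilon>)\<^sup>2 * w\<^sup>2) = cnj (of_real (R ^ 3 * d) * \<epsilon>\<^sup>2) * w\<^sup>2"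
    by simp
  also have "\<dots> = i * cnj z\<^sub>1 * (w\<^sup>2 * cnj (z\<^sub>2 * z\<^sub>3))"
    using axis unfolding d_def[symmetric] \<epsilon>_def[symmetric] z[symmetric] i_def[symmetric] by simp
  also have "\<dots> = of_real (R\<^sup>2 * d\<^sup>2) * (cnj i * z\<^sub>1) + of_real (R ^ 4) * cnj (cnj i * z\<^sub>1)
      - of_real (2 * R ^ 4 * d\<^sup>2)"
  proof -
    \<comment> \<open>In the first two monomials of the expanded square, \<open>z\<^sub>1\<close>
      meets its conjugate and \<open>i\<close> meets its own, so only terms linear in
      \<open>cnj i * z\<^sub>1\<close> or its conjugate and a constant survive.\<close>
    have "i * z' * (i' * z\<^sub>1 - \<rho>)\<^sup>2 = (\<rho> * \<delta>) * (i' * z\<^sub>1) + \<rho>\<^sup>2 * (i * z') - 2 * \<rho>\<^sup>2 * \<delta>"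
      if "z\<^sub>1 * z' = \<rho>" "i * i' = \<delta>" for z' i' \<rho> \<delta> :: complex
      unfolding that[symmetric] by (simp add: power2_eq_square algebra_simps)
    from this[OF zz(1) ii] show ?thesis
      unfolding chord by (simp add: power4_eq_xxxx power2_eq_square mult_ac)
  qed
  finally have *: "of_real (R ^ 3 * d) * ((cnj \<epsilon>)\<^sup>2 * w\<^sup>2) = of_real (R\<^sup>2 * d\<^sup>2) * (cnj i * z\<^sub>1)
      + of_real (R ^ 4) * cnj (cnj i * z\<^sub>1) - of_real (2 * R ^ 4 * d\<^sup>2)" .
  have Re_mult: "Re (of_real k * v) = k * Re v" for k v
    by simp
  have "Re (of_real (R ^ 3 * d) * ((cnj \<epsilon>)\<^sup>2 * w\<^sup>2)) = R\<^sup>2 * d\<^sup>2 * c + R ^ 4 * c - 2 * R ^ 4 * d\<^sup>2"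
    unfolding * minus_complex.sel plus_complex.sel Re_mult cnj.sel Re_complex_of_real c_def ..
  then have "R\<^sup>2 * (R * d * Re ((cnj \<epsilon>)\<^sup>2 * w\<^sup>2)) = R\<^sup>2 * (d\<^sup>2 * c + R\<^sup>2 * c - 2 * R\<^sup>2 * d\<^sup>2)"
    unfolding Re_mult by (simp add: algebra_simps power3_eq_cube power4_eq_xxxx power2_eq_square)
  then have re: "R * d * Re ((cnj \<epsilon>)\<^sup>2 * w\<^sup>2) = d\<^sup>2 * c + R\<^sup>2 * c - 2 * R\<^sup>2 * d\<^sup>2"
    using R by simp
  have diff: "Re ((cnj \<epsilon>)\<^sup>2 * w\<^sup>2) = (e \<bullet> (A - I))\<^sup>2 - (perp e \<bullet> (A - I))\<^sup>2"
  proof -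
    have "cnj \<epsilon> * w = Complex (e \<bullet> (A - I)) (perp e \<bullet> (A - I))"
      by (simp add: \<epsilon>_def w_def to_complex_def complex_eq_iff inner_real2)
    then show ?thesis
      by (simp flip: power_mult_distrib) (simp add: power2_eq_square)
  qed
  have sum: "(e \<bullet> (A - I))\<^sup>2 + (perp e \<bullet> (A - I))\<^sup>2 = R\<^sup>2 + d\<^sup>2 - 2 * c"
  proof -
    have "(e \<bullet> (A - I))\<^sup>2 + (perp e \<bullet> (A - I))\<^sup>2 = (A - I) \<bullet> (A - I)"
      using arg_cong[OF perp_expansion[OF e, of "A - I"], of "(\<bullet>) (A - I)"]
      by (simp only: inner_add_right inner_scaleR_right inner_commute[of _ e]
          inner_commute[of _ "perp e"] power2_eq_square)
    also have "\<dots> = (norm (z\<^sub>1 - i))\<^sup>2"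
      unfolding w[symmetric] w_def to_complex_simps(5) power2_norm_eq_inner ..
    also have "\<dots> = (norm z\<^sub>1)\<^sup>2 + (norm i)\<^sup>2 - 2 * c"
      unfolding c_def cmod_power2 by (simp add: power2_eq_square algebra_simps)
    finally show ?thesis
      using circum(1) by (simp add: z i_def d_def dist_norm del: to_complex_simps(2))
  qed
  \<comment> \<open>Splits the form into trace and traceless parts, evaluated by \<open>sum\<close>
    and \<open>re\<close>. The terms in \<open>c\<close> cancel, and
    \<open>(R^2 + d^2)^2 - (2 * R * d)^2 = K^2\<close> remains.\<close>
  have "(R + d)\<^sup>2 * s + (R - d)\<^sup>2 * t = (R\<^sup>2 + d\<^sup>2) * (s + t) + 2 * (R * d * (s - t))" for s t
    by (simp add: power2_eq_square algebra_simps)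
  from this[of "(e \<bullet> (A - I))\<^sup>2" "(perp e \<bullet> (A - I))\<^sup>2"] show ?thesis
    unfolding sum diff[symmetric] re d_def[symmetric] K_def
    by (simp add: power2_eq_square algebra_simps)
qed

lemma (in poristic_triangle) I3'_eq_ellipse:
  "\<exists>e. norm e = 1 \<and> I3' (A, B, C) = ellipse (2 *\<^sub>R X\<^sub>3 - I) e (R + dist I X\<^sub>3) (R - dist I X\<^sub>3)"
proof -
  define s where "s = cnj (to_complex (I - X\<^sub>3)) *
    (to_complex (A - X\<^sub>3) * to_complex (B - X\<^sub>3) * to_complex (C - X\<^sub>3))"
  have s: "norm s = R ^ 3 * dist I X\<^sub>3"
    using circum by (simp add: s_def norm_mult dist_norm power3_eq_cube del: to_complex_simps(2))
  have "R \<ge> 0"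
    using circum(1) by auto
  have "(dist I X\<^sub>3)\<^sup>2 < R\<^sup>2"
    using K_pos by (simp add: K_def)
  then have less: "dist I X\<^sub>3 < R"
    using \<open>R \<ge> 0\<close> by (simp add: power_less_imp_less_base)
  obtain \<epsilon> where \<epsilon>: "norm \<epsilon> = 1" "of_real (norm s) * \<epsilon>\<^sup>2 = s"
  proof
    \<comment> \<open>The square root halves the argument of \<open>s\<close>. If
      \<open>s = 0\<close>, the two centers coincide, the ellipse is a circle, and the default axis
      1 is as good as any.\<close>
    define \<epsilon> where "\<epsilon> = (if s = 0 then 1 else csqrt (sgn s))"
    show "norm \<epsilon> = 1"
      by (simp add: \<epsilon>_def norm_sgn)
    show "of_real (norm s) * \<epsilon>\<^sup>2 = s"
      by (simp add: \<epsilon>_def sgn_eq)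
  qed
  define e :: "real^2" where "e = vector [Re \<epsilon>, Im \<epsilon>]"
  have e: "to_complex e = \<epsilon>"
    by (simp add: to_complex_def e_def)
  then have norm_e: "norm e = 1"
    using \<epsilon>(1) by (metis to_complex_simps(5))
  have q: "(R + dist I X\<^sub>3)\<^sup>2 * (e \<bullet> (P - I))\<^sup>2 + (R - dist I X\<^sub>3)\<^sup>2 * (perp e \<bullet> (P - I))\<^sup>2 = K\<^sup>2"
    if "P \<in> {A, B, C}" for P
  proof -
    have axis: "of_real (R ^ 3 * dist I X\<^sub>3) * (to_complex e)\<^sup>2 = s"
      using \<epsilon>(2) unfolding e s .
    note r1 = rotate_poristic
    note r2 = poristic_triangle.rotate_poristic[OF r1]
    show ?thesis
      using that vertex_quadratic_form[OF norm_e axis[unfolded s_def]]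
        poristic_triangle.vertex_quadratic_form[OF r1 norm_e]
        poristic_triangle.vertex_quadratic_form[OF r2 norm_e] axis
      by (auto simp: s_def mult_ac)
  qed
  have "I3' (A, B, C) = ellipse (2 *\<^sub>R X\<^sub>3 - I) e (R + dist I X\<^sub>3) (R - dist I X\<^sub>3)"
    unfolding I3'_def circumcenter_excentral
    using less \<open>R \<ge> 0\<close> by (intro inconic_excentral_eq norm_e q) (auto simp: add_nonneg_eq_0_iff)
  then show ?thesis
    using norm_e by blast
qed

theorem theorem2:
  fixes R r d :: real and X1 X3 X40 :: point
  assumes "R \<ge> 2 * r" and "2 * r > 0"
    and "d = sqrt (R * (R - 2 * r))"
    and "dist X1 X3 = d"
    and "X40 = 2 *\<^sub>R X3 - X1"
  shows "(\<forall>T \<in> poristic_family X3 R X1 r.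
            circumcenter (excentral T) = X40 \<and>
            (\<forall>\<mu> \<nu>. is_ellipse (I3' T) (circumcenter (excentral T)) \<mu> \<nu> \<longleftrightarrow> \<mu> = R + d \<and> \<nu> = R - d)) \<and>
         (\<forall>T \<in> poristic_family X3 R X1 r. \<forall>T' \<in> poristic_family X3 R X1 r.
            \<exists>Q. rotation_matrix Q \<and> I3' T' = rotate_about X40 Q ` I3' T)"
proof -
  have "0 \<le> R * (R - 2 * r)"
    using assms(1,2) by simp
  then have "d\<^sup>2 = R\<^sup>2 - R * (2 * r)"
    unfolding assms(3) by (simp add: power2_eq_square algebra_simps)
  moreover have "0 < R * (2 * r)"
    using assms(1,2) by (intro mult_pos_pos) auto
  ultimately have "d < R"
    using assms(1,2) by (intro power_less_imp_less_base[of d 2 R]) auto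
  have d: "0 \<le> d"
    using assms(4) by auto
  have T: "circumcenter (excentral T) = X40 \<and> (\<exists>e. norm e = 1 \<and> I3' T = ellipse X40 e (R + d) (R - d))"
    if mem: "T \<in> poristic_family X3 R X1 r" for T
  proof -
    obtain A B C where T: "T = (A, B, C)" "\<not> collinear {A, B, C}"
      "is_circumcircle (A, B, C) X3 R" "is_incircle (A, B, C) X1 r"
      using mem unfolding poristic_family_def by blast
    obtain x y z where "incenter_triangle A B C X1 x y z r"
      using is_incircle_imp_incenter_triangle[OF T(2,4)] .
    then have "poristic_triangle A B C X1 x y z r X3 R"
      using T(3) by (auto simp: poristic_triangle_def poristic_triangle_axioms_def dist_commute)
    from poristic_triangle.circumcenter_excentral[OF this] poristic_triangle.I3'_eq_ellipse[OF this]
    show ?thesis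
      unfolding T(1) assms(4,5) by blast
  qed
  show ?thesis
  proof (intro conjI ballI)
    fix T assume mem: "T \<in> poristic_family X3 R X1 r"
    show "circumcenter (excentral T) = X40"
      using T[OF mem] by blast
    have "is_ellipse (I3' T) X40 (R + d) (R - d)"
      unfolding is_ellipse_iff using T[OF mem] \<open>d < R\<close> d by auto
    then show "\<forall>\<mu> \<nu>. is_ellipse (I3' T) (circumcenter (excentral T)) \<mu> \<nu> \<longleftrightarrow> \<mu> = R + d \<and> \<nu> = R - d"
      using T[OF mem] is_ellipse_semiaxes_unique by metis
  next
    fix T T' assume "T \<in> poristic_family X3 R X1 r" "T' \<in> poristic_family X3 R X1 r"
    then show "\<exists>Q. rotation_matrix Q \<and> I3' T' = rotate_about X40 Q ` I3' T"
      using T rotation_of_ellipse by metis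
  qed
qed

end
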